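(* Let $V=\mathbb R^d$, $n\ge1$, and let $\mathbb X,\mathbb Y$ be two level-$n$ smooth geometric rough paths over $I=J=[0,T]$ with diagonal derivatives $$\dot{\bm x}_s=\partial_v|_{v=s}\mathbb X_{s,v}\in\mathcal L^n(V),\qquad \dot{\bm y}_t=\partial_v|_{v=t}\mathbb Y_{t,v}\in\mathcal L^n(V).$$ Define for $(s,t)\in I\times J$ $$f(s,t)=\langle S(\mathbb X)_{0,s},S(\mathbb Y)_{0,t}\rangle,$$ $$\varphi(s,t)=\pi_{\le n}\big(L^*_{S(\mathbb Y)_{0,t}}(S(\mathbb X)_{0,s})-f(s,t)\mathbb 1\big),\qquad \psi(s,t)=\pi_{\le n}\big(L^*_{S(\mathbb X)_{0,s}}(S(\mathbb Y)_{0,t})-f(s,t)\mathbb 1\big).$$ Then $(f,\varphi,\psi)$ solves the linear system $$\frac{\partial^2f}{\partial s\,\partial t}=\langle\dot{\bm x}_s,\dot{\bm y}_t\rangle f+\langle\varphi,R^*_{\dot{\bm x}_s}(\dot{\bm y}_t)\rangle+\langle\psi,R^*_{\dot{\bm y}_t}(\dot{\bm x}_s)\rangle,$$ $$\frac{\partial\varphi}{\partial s}=\dot{\bm x}_sf+\varphi\otimes_n\dot{\bm x}_s+L^*_\psi(\dot{\bm x}_s)-\langle\psi,\dot{\bm x}_s\rangle\mathbb 1_n,$$ $$\frac{\partial\psi}{\partial t}=\dot{\bm y}_tf+\psi\otimes_n\dot{\bm y}_t+L^*_\varphi(\dot{\bm y}_t)-\langle\varphi,\dot{\bm y}_t\rangle\mathbb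 1_n,$$ with boundary conditions $f(0,t)=f(s,0)=1$, $\psi(0,t)=\mathbb Y_{0,t}-\mathbb 1_n$, $\varphi(0,t)=0$, $\varphi(s,0)=\mathbb X_{0,s}-\mathbb 1_n$, $\psi(s,0)=0$.
   Context: $T((V))=\prod_{k\ge0}V^{\otimes k}$ with product $(\mathbb A\cdot\mathbb B)^m=\sum_{k=0}^ma^k\otimes b^{m-k}$ and unit $\mathbb 1=(1,0,0,\dots)$. $T^n(V)=\bigoplus_{k=0}^nV^{\otimes k}$ with truncated product $\otimes_n$ and unit $\mathbb 1_n$; $\pi_{\le n}:T((V))\to T^n(V)$ is the projection. Each $V^{\otimes k}$ carries the Hilbert–Schmidt inner product $\langle\cdot,\cdot\rangle_k$ from the Euclidean structure, and $\langle\mathbb A,\mathbb B\rangle=\sum_k\langle a^k,b^k\rangle_k$. $\mathcal L^n(V)$ is the step-$n$ free Lie algebra over $V$: the elements $(0,l^1,\dots,l^n)$ with $l^k\in L_k$, where $L_1=V$ and $L_{k+1}=[V,L_k]$ (span of commutators). $L^*_{\mathbb A}$ and $R^*_{\mathbb A}$ are the adjoints of $\mathbb C\mapsto\mathbb A\cdot\mathbb C$ and $\mathbb C\mapsto\mathbb C\cdot\mathbb A$: $\langle L^*_{\mathbb A}(\mathbb B),c\rangle=\langle\mathbb B,\mathbb A\cdot c\rangle$ and $\langle R^*_{\mathbb A}(\mathbb B),c\rangle=\langle\mathbb B,c\cdot\mathbb A\rangle$ for all $c$ with finitely many nonzero components (whenever these converge, as they do for signatures). A level-$n$ smooth geometric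 rough path is a (nonzero) path $\mathbb X:[0,T]\to T^n(V)$ such that $\langle\mathbb X_t,v\sqcup\!\sqcup w\rangle=\langle\mathbb X_t,v\rangle\langle\mathbb X_t,w\rangle$ (shuffle product) for all $t$ and all words $v,w$ with $|v|+|w|\le n$, and $t\mapsto\langle\mathbb X_t,w\rangle$ is smooth for every word $|w|\le n$; $\mathbb X_{s,t}=\mathbb X_s^{-1}\otimes_n\mathbb X_t$. Its signature $S(\mathbb X)_{0,s}\in T((V))$ is the solution of $\partial_sS(\mathbb X)_{0,s}=S(\mathbb X)_{0,s}\cdot\dot{\bm x}_s$, $S(\mathbb X)_{0,0}=\mathbb 1$; it satisfies $\pi_{\le n}S(\mathbb X)_{0,s}=\mathbb X_{0,s}$. *)

theory Defs
  imports "HOL-Analysis.Analysis" "HOL-Library.Function_Algebras"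
begin

section \<open>The tensor series over a Euclidean space, in coordinates\<close>

text \<open>
  For \<open>V = real ^ 'd\<close> the words of length \<open>k\<close> over \<open>'d\<close> index the basis
  \<open>e_{i1} \<otimes> \<dots> \<otimes> e_{ik}\<close> of the \<open>k\<close>-th tensor power, which is orthonormal for the
  Hilbert--Schmidt inner product.  An element of \<open>T((V))\<close> is therefore given by its
  coefficient function, and an element of \<open>T^n(V)\<close> by a coefficient function that vanishes on
  words longer than \<open>n\<close>.

  Addition, subtraction and \<open>0\<close> are pointwise.  The pointwise \<open>*\<close> and \<open>1\<close> that
  \<^theory>\<open>HOL-Library.Function_Algebras\<close> also provides are not the tensor product and
  its unit, and are not used on tensors.
\<close>

type_synonym 'd tens = "'d list \<Rightarrow> real"

instantiation "fun" :: (type, real_vector) real_vector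
begin

definition scaleR_fun :: "real \<Rightarrow> ('a \<Rightarrow> 'b) \<Rightarrow> 'a \<Rightarrow> 'b"
  where "scaleR_fun r f = (\<lambda>x. r *\<^sub>R f x)"

instance
  by standard (simp_all add: scaleR_fun_def fun_eq_iff scaleR_add_right scaleR_add_left)

end

definition tunit :: "'d tens" ("\<one>\<^sub>T")
  where "\<one>\<^sub>T = (\<lambda>w. if w = [] then 1 else 0)"

definition word_tens :: "'d list \<Rightarrow> 'd tens"
  where "word_tens w = (\<lambda>u. if u = w then 1 else 0)"

text \<open>
  Each way of cutting \<open>w\<close> into a prefix of length \<open>i\<close> and a suffix contributes the
  \<open>w\<close>-coordinate of \<open>a^i \<otimes> b^{m-i}\<close>, where \<open>m = length w\<close>.
\<close>

definition tmult :: "'d tens \<Rightarrow> 'd tens \<Rightarrow> 'd tens" (infixl "\<odot>" 70)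
  where "A \<odot> B = (\<lambda>w. \<Sum>i\<le>length w. A (take i w) * B (drop i w))"

definition tlevel :: "nat \<Rightarrow> 'd tens \<Rightarrow> 'd tens"
  where "tlevel k A = (\<lambda>w. if length w = k then A w else 0)"

definition ttrunc :: "nat \<Rightarrow> 'd tens \<Rightarrow> 'd tens"
  where "ttrunc n A = (\<lambda>w. if length w \<le> n then A w else 0)"

definition trunc_space :: "nat \<Rightarrow> 'd tens set"
  where "trunc_space n = {A. \<forall>w. n < length w \<longrightarrow> A w = 0}"

definition tmult_trunc :: "nat \<Rightarrow> 'd tens \<Rightarrow> 'd tens \<Rightarrow> 'd tens"
  where "tmult_trunc n A B = ttrunc n (A \<odot> B)"

definition tinv :: "nat \<Rightarrow> 'd tens \<Rightarrow> 'd tens"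
  where "tinv n A = (THE B. B \<in> trunc_space n \<and>
           tmult_trunc n A B = \<one>\<^sub>T \<and> tmult_trunc n B A = \<one>\<^sub>T)"

definition level_inner :: "nat \<Rightarrow> 'd::finite tens \<Rightarrow> 'd tens \<Rightarrow> real"
  where "level_inner k A B = (\<Sum>w | length w = k. A w * B w)"

definition tinner :: "'d::finite tens \<Rightarrow> 'd tens \<Rightarrow> real"
  where "tinner A B = (\<Sum>k. level_inner k A B)"

definition finitary :: "'d tens \<Rightarrow> bool"
  where "finitary c \<longleftrightarrow> (\<exists>N. c \<in> trunc_space N)"


section \<open>Adjoints of left and right multiplication\<close>

text \<open>
  Convergence of the pairings with \<open>B\<close> is part of being an adjoint.  The adjoint is unique when
  it exists, since \<open>c\<close> may be any word.
\<close>

definition is_left_adj :: "'d::finite tens \<Rightarrow> 'd tens \<Rightarrow> 'd tens \<Rightarrow> bool"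
  where "is_left_adj A B D \<longleftrightarrow>
    (\<forall>c. finitary c \<longrightarrow> (\<lambda>k. level_inner k B (A \<odot> c)) sums tinner D c)"

definition is_right_adj :: "'d::finite tens \<Rightarrow> 'd tens \<Rightarrow> 'd tens \<Rightarrow> bool"
  where "is_right_adj A B D \<longleftrightarrow>
    (\<forall>c. finitary c \<longrightarrow> (\<lambda>k. level_inner k B (c \<odot> A)) sums tinner D c)"

definition left_adj :: "'d::finite tens \<Rightarrow> 'd tens \<Rightarrow> 'd tens"
  where "left_adj A B = (THE D. is_left_adj A B D)"

definition right_adj :: "'d::finite tens \<Rightarrow> 'd tens \<Rightarrow> 'd tens"
  where "right_adj A B = (THE D. is_right_adj A B D)"


section \<open>Shuffle product and free Lie algebra\<close>

text \<open>
  The library's \<^const>\<open>shuffles\<close> is a set and forgets multiplicities; here they are kept.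
\<close>

fun shuffle :: "'d list \<Rightarrow> 'd list \<Rightarrow> 'd tens"
  where
    "shuffle [] w = word_tens w"
  | "shuffle (a # v) [] = word_tens (a # v)"
  | "shuffle (a # v) (b # w) =
       word_tens [a] \<odot> shuffle v (b # w) + word_tens [b] \<odot> shuffle (a # v) w"

text \<open>
  Layer \<open>0\<close> is zero because elements of the free Lie algebra have no scalar part.
\<close>

fun lie_layer :: "nat \<Rightarrow> 'd tens set"
  where
    "lie_layer 0 = {0}"
  | "lie_layer (Suc 0) = {a. \<forall>w. length w \<noteq> 1 \<longrightarrow> a w = 0}"
  | "lie_layer (Suc (Suc k)) =
       span {v \<odot> l - l \<odot> v | v l. v \<in> lie_layer (Suc 0) \<and> l \<in> lie_layer (Suc k)}"

definition lie_algebra :: "nat \<Rightarrow> 'd tens set"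
  where "lie_algebra n = {a \<in> trunc_space n. \<forall>k\<le>n. tlevel k a \<in> lie_layer k}"


section \<open>Smooth geometric rough paths and their signatures\<close>

text \<open>
  Derivatives on \<open>{0..T}\<close> are one-sided at the end points; \<open>G k\<close> is the \<open>k\<close>-th derivative.
\<close>

definition smooth_on_interval :: "real \<Rightarrow> (real \<Rightarrow> real) \<Rightarrow> bool"
  where "smooth_on_interval T g \<longleftrightarrow>
    (\<exists>G :: nat \<Rightarrow> real \<Rightarrow> real. G 0 = g \<and>
      (\<forall>k. \<forall>t\<in>{0..T}. (G k has_real_derivative G (Suc k) t) (at t within {0..T})))"

definition has_tens_derivative :: "(real \<Rightarrow> 'd tens) \<Rightarrow> 'd tens \<Rightarrow> real filter \<Rightarrow> bool"
  where "has_tens_derivative F D Fl \<longleftrightarrow>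
    (\<forall>w. ((\<lambda>u. F u w) has_real_derivative D w) Fl)"

definition smooth_geometric_rough_path ::
    "real \<Rightarrow> nat \<Rightarrow> (real \<Rightarrow> 'd::finite tens) \<Rightarrow> bool"
  where "smooth_geometric_rough_path T n X \<longleftrightarrow>
    (\<forall>t\<in>{0..T}. X t \<in> trunc_space n \<and> X t \<noteq> 0 \<and>
      (\<forall>v w. length v + length w \<le> n \<longrightarrow> tinner (X t) (shuffle v w) = X t v * X t w)) \<and>
    (\<forall>w. length w \<le> n \<longrightarrow> smooth_on_interval T (\<lambda>t. X t w))"

definition increment :: "nat \<Rightarrow> (real \<Rightarrow> 'd tens) \<Rightarrow> real \<Rightarrow> real \<Rightarrow> 'd tens"
  where "increment n X s t = tmult_trunc n (tinv n (X s)) (X t)"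

definition diag_deriv :: "real \<Rightarrow> nat \<Rightarrow> (real \<Rightarrow> 'd tens) \<Rightarrow> real \<Rightarrow> 'd tens"
  where "diag_deriv T n X s =
    (\<lambda>w. vector_derivative (\<lambda>v. increment n X s v w) (at s within {0..T}))"

definition is_signature ::
    "real \<Rightarrow> nat \<Rightarrow> (real \<Rightarrow> 'd tens) \<Rightarrow> (real \<Rightarrow> 'd tens) \<Rightarrow> bool"
  where "is_signature T n X S \<longleftrightarrow> S 0 = \<one>\<^sub>T \<and>
    (\<forall>s\<in>{0..T}. has_tens_derivative S (S s \<odot> diag_deriv T n X s) (at s within {0..T}))"

text \<open>
  The solution is unique on \<open>{0..T}\<close> only; outside that interval the chosen values are
  arbitrary.
\<close>

definition signature :: "real \<Rightarrow> nat \<Rightarrow> (real \<Rightarrow> 'd tens) \<Rightarrow> real \<Rightarrow> 'd tens"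
  where "signature T n X = (SOME S. is_signature T n X S)"


section \<open>Mixed partial derivatives\<close>

text \<open>
  Both iterated partial derivatives exist on \<open>I \<times> J\<close> and equal \<open>F\<close>.
\<close>

definition has_mixed_partial_on ::
    "(real \<Rightarrow> real \<Rightarrow> real) \<Rightarrow> (real \<Rightarrow> real \<Rightarrow> real) \<Rightarrow> real set \<Rightarrow> real set \<Rightarrow> bool"
  where "has_mixed_partial_on f F I J \<longleftrightarrow>
    (\<exists>g. \<forall>s\<in>I. \<forall>t\<in>J.
      ((\<lambda>v. f s v) has_real_derivative g s t) (at t within J) \<and>
      ((\<lambda>u. g u t) has_real_derivative F s t) (at s within I)) \<and>
    (\<exists>h. \<forall>s\<in>I. \<forall>t\<in>J.
      ((\<lambda>u. f u t) has_real_derivative h s t) (at s within I) \<and>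
      ((\<lambda>v. h s v) has_real_derivative F s t) (at t within J))"

end

theory Submission
  imports Defs
begin

text \<open>
  A character of the shuffle algebra that varies along \<open>X' = X \<odot> x\<close> forces \<open>x\<close> to vanish on proper
  shuffles, and the Dynkin operator, which multiplies such an \<open>x\<close> by the degree, exhibits it as a Lie
  element.  The signature decays faster than any geometric sequence, so all pairings may be
  differentiated term by term.  What is left is one algebraic identity: the adjoint \<open>L\<^sup>*\<^sub>B\<close> applied to
  \<open>A \<odot> x\<close> splits according to whether the cut between \<open>A\<close> and \<open>x\<close> falls to the left or to the right
  of the end of \<open>B\<close>, and each part is again an adjoint.
\<close>

section \<open>The tensor algebra\<close>

text \<open>Two facts shape the analysis. The diagonal derivative has no scalar part, so the value
  of \<open>S \<odot> x\<close> at a word involves \<open>S\<close> at proper prefixes only: the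
  signature equation is triangular in word length. Existence, agreement with the increments up to
  degree \<open>n\<close>, and the decay bound are therefore all inductions on length, with no
  fixed-point argument. Second, the adjoints have explicit coordinates, pairings with shifted
  tensors \<open>\<lambda>v. B (v @ u)\<close>, but these are series over exponentially many words;
  since \<open>left_adj\<close> and \<open>right_adj\<close> are definite descriptions, convergence
  must be known before either can be evaluated. Subtracting \<open>f\<close> times the unit removes
  the scalar parts of \<open>\<phi>\<close> and \<open>\<psi>\<close>, so the overlap
  \<open>f\<close> is not counted twice, and truncating them is harmless because \<open>x\<close>
  and \<open>y\<close> live in degrees up to \<open>n\<close>. Only derivatives in \<open>s\<close>
  are ever computed: exchanging the two paths exchanges \<open>\<phi>\<close> with
  \<open>\<psi>\<close> and yields those in \<open>t\<close>.\<close>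

lemma tmult_Nil [simp]: "(A \<odot> B) [] = A [] * B []"
  by (simp add: tmult_def)

text \<open>The cut lies before the first letter or after it. In the second case the left factor is
  shifted, so inductions along words must generalise over it.\<close>

lemma tmult_Cons: "(A \<odot> B) (c # u) = A [] * B (c # u) + ((\<lambda>v. A (c # v)) \<odot> B) u"
  by (simp add: tmult_def sum.atMost_Suc_shift del: sum.atMost_Suc)

text \<open>Isolates the only cut at which \<open>A\<close> sees the whole word. With
  \<open>B [] = 0\<close> just proper prefixes remain, which is what makes the signature equation
  triangular.\<close>

lemma tmult_eq_sum_below:
  "(A \<odot> B) w = (\<Sum>i<length w. A (take i w) * B (drop i w)) + A w * B []"
  by (simp add: tmult_def lessThan_Suc_atMost[symmetric])

lemma tmult_lin_left:
  "((\<lambda>v. r * A v + B v) \<odot> C) w = r * (A \<odot> C) w + (B \<odot> C) w"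
  by (simp add: tmult_def algebra_simps sum.distrib sum_distrib_left)

lemma tmult_assoc: "(A \<odot> B) \<odot> C = A \<odot> (B \<odot> C)"
proof
  show "((A \<odot> B) \<odot> C) w = (A \<odot> (B \<odot> C)) w" for w
  proof (induction w arbitrary: A)
    case (Cons c u)
    show ?case
      by (simp add: tmult_Cons[of "A \<odot> B"] tmult_Cons[of A B] tmult_lin_left Cons.IH
          tmult_Cons[of A "B \<odot> C"] tmult_Cons[of B C] algebra_simps)
  qed simp
qed

lemma tunit_tmult [simp]: "\<one>\<^sub>T \<odot> A = A"
proof
  show "(\<one>\<^sub>T \<odot> A) w = A w" for w
  proof (cases w)
    case (Cons c u)
    then show ?thesis
      by (simp add: tmult_Cons) (simp add: tmult_def tunit_def)
  qed (simp add: tunit_def)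
qed

lemma tmult_tunit [simp]: "A \<odot> \<one>\<^sub>T = A"
proof
  show "(A \<odot> \<one>\<^sub>T) w = A w" for w
    by (induction w arbitrary: A) (simp_all add: tmult_Cons tunit_def)
qed

text \<open>The cut falls inside \<open>v\<close>, its end included, or strictly inside the block
  \<open>w\<close> or at its end. The cut between the two words is counted in the first term, hence
  the sum starts at 1.\<close>

lemma tmult_append:
  "(A \<odot> B) (v @ w) =
     (A \<odot> (\<lambda>p. B (p @ w))) v + (\<Sum>i=1..length w. A (v @ take i w) * B (drop i w))"
proof (induction v arbitrary: A)
  case Nil
  then show ?case
    by (simp add: tmult_def atMost_atLeast0 sum.atLeast_Suc_atMost)
next
  case (Cons c v)
  then show ?case
    by (simp add: tmult_Cons)
qed

section \<open>Truncation and inverses\<close>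

lemma ttrunc_apply: "length w \<le> n \<Longrightarrow> ttrunc n A w = A w"
  by (simp add: ttrunc_def)

lemma ttrunc_in_trunc_space [simp]: "ttrunc n A \<in> trunc_space n"
  by (simp add: ttrunc_def trunc_space_def)

lemma ttrunc_id: "A \<in> trunc_space n \<Longrightarrow> ttrunc n A = A"
  by (auto simp add: ttrunc_def trunc_space_def fun_eq_iff)

lemma ttrunc_tunit [simp]: "ttrunc n \<one>\<^sub>T = \<one>\<^sub>T"
  by (auto simp add: ttrunc_def tunit_def fun_eq_iff)

lemma tmult_cong_up_to:
  assumes "length w \<le> n" "\<And>u. length u \<le> n \<Longrightarrow> A u = A' u" "\<And>u. length u \<le> n \<Longrightarrow> B u = B' u"
  shows "(A \<odot> B) w = (A' \<odot> B') w"
  unfolding tmult_def using assms by (intro sum.cong) auto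

lemma ttrunc_tmult_ttrunc_left [simp]: "ttrunc n (ttrunc n A \<odot> B) = ttrunc n (A \<odot> B)"
  by (auto simp: ttrunc_def fun_eq_iff intro!: tmult_cong_up_to)

lemma ttrunc_tmult_ttrunc_right [simp]: "ttrunc n (A \<odot> ttrunc n B) = ttrunc n (A \<odot> B)"
  by (auto simp: ttrunc_def fun_eq_iff intro!: tmult_cong_up_to)

text \<open>The equation \<open>(linv A \<odot> A) w = \<one>\<^sub>T w\<close>, solved for the
  summand \<open>linv A w\<close> under the assumption \<open>A [] = 1\<close>.\<close>

function linv :: "'d tens \<Rightarrow> 'd list \<Rightarrow> real"
  where "linv A w = (if w = [] then 1 else - (\<Sum>i<length w. linv A (take i w) * A (drop i w)))"
  by auto
termination by (relation "Wellfounded.measure (\<lambda>(A, w). length w)") auto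

declare linv.simps [simp del]

lemma linv_tmult:
  assumes "A [] = 1"
  shows "linv A \<odot> A = \<one>\<^sub>T"
proof
  show "(linv A \<odot> A) w = \<one>\<^sub>T w" for w
    unfolding tmult_eq_sum_below assms by (subst (2) linv.simps) (simp add: tunit_def)
qed

lemma linv_Nil [simp]: "linv A [] = 1"
  by (subst linv.simps) simp

text \<open>\<open>linv A\<close> again has scalar part 1, so it has a left inverse itself; by
  associativity that left inverse is \<open>A\<close>.\<close>

lemma tmult_linv:
  assumes "A [] = 1"
  shows "A \<odot> linv A = \<one>\<^sub>T"
proof -
  let ?B = "linv A"
  have "linv ?B = linv ?B \<odot> (?B \<odot> A)"
    using assms by (simp add: linv_tmult)
  also have "\<dots> = A"
    by (simp add: tmult_assoc[symmetric] linv_tmult)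
  finally show ?thesis
    using linv_tmult[of ?B] by simp
qed

text \<open>The truncated inverse is the truncation of an inverse in the full algebra, so
  computations can be done there and truncated once at the end.\<close>

lemma tinv_eq:
  assumes "A [] = 1"
  shows "tinv n A = ttrunc n (linv A)"
  unfolding tinv_def tmult_trunc_def
proof (rule the_equality)
  show "ttrunc n (linv A) \<in> trunc_space n \<and> ttrunc n (A \<odot> ttrunc n (linv A)) = \<one>\<^sub>T \<and>
    ttrunc n (ttrunc n (linv A) \<odot> A) = \<one>\<^sub>T"
    using assms by (simp add: linv_tmult tmult_linv)
next
  fix B assume B: "B \<in> trunc_space n \<and> ttrunc n (A \<odot> B) = \<one>\<^sub>T \<and> ttrunc n (B \<odot> A) = \<one>\<^sub>T"
  have "B = ttrunc n (linv A \<odot> A \<odot> B)"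
    using B assms by (simp add: linv_tmult ttrunc_id)
  also have "\<dots> = ttrunc n (linv A \<odot> ttrunc n (A \<odot> B))"
    by (simp add: tmult_assoc)
  finally show "B = ttrunc n (linv A)"
    using B by simp
qed

lemma increment_eq:
  "X s [] = 1 \<Longrightarrow> increment n X s t = ttrunc n (linv (X s) \<odot> X t)"
  by (simp add: increment_def tmult_trunc_def tinv_eq)

section \<open>Shuffles\<close>

lemma finite_words_length [simp]: "finite {w :: 'd::finite list. length w = k}"
  using finite_lists_length_eq[of "UNIV :: 'd set" k] by simp

lemma tinner_cong_level:
  fixes A B :: "'d::finite tens"
  assumes "\<And>w. length w \<noteq> k \<Longrightarrow> B w = 0"
  shows "tinner A B = level_inner k A B"
proof -
  have "tinner A B = (\<Sum>j\<in>{k}. level_inner j A B)"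
    unfolding tinner_def
    by (rule suminf_finite) (use assms in \<open>auto simp: level_inner_def\<close>)
  then show ?thesis by simp
qed

lemma level_inner_word_tens [simp]: "level_inner (length w) A (word_tens w) = A w"
proof -
  have "level_inner (length w) A (word_tens w) = (\<Sum>u\<in>{w}. A u)"
    unfolding level_inner_def word_tens_def
    by (rule sum.mono_neutral_cong_right) auto
  then show ?thesis by simp
qed

lemma tinner_word_tens [simp]: "tinner A (word_tens w) = A w"
proof -
  have "tinner A (word_tens w) = level_inner (length w) A (word_tens w)"
    by (rule tinner_cong_level) (auto simp: word_tens_def)
  then show ?thesis by simp
qed

lemma tinner_tunit: "tinner A \<one>\<^sub>T = A []"
  using tinner_word_tens[of A "[]"] by (simp add: word_tens_def tunit_def)

text \<open>The pairing of \<open>a\<close> with the shuffle product, see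
  \<open>tinner_shuffle\<close>. Passing first letters to \<open>a\<close> keeps multiplicities and
  avoids sums over words, so the Hopf-algebraic identities below become plain inductions.\<close>

fun shuffle_pairing :: "'d tens \<Rightarrow> 'd list \<Rightarrow> 'd list \<Rightarrow> real"
  where
    "shuffle_pairing a [] w = a w"
  | "shuffle_pairing a (c # v) [] = a (c # v)"
  | "shuffle_pairing a (c # v) (b # w) =
       shuffle_pairing (\<lambda>u. a (c # u)) v (b # w) + shuffle_pairing (\<lambda>u. a (b # u)) (c # v) w"

lemma shuffle_pairing_Nil_right [simp]: "shuffle_pairing a v [] = a v"
  by (cases v) auto

lemma tmult_word_tens_Cons:
  "(word_tens [c] \<odot> A) w = (case w of [] \<Rightarrow> 0 | b # u \<Rightarrow> if b = c then A u else 0)"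
proof (cases w)
  case (Cons b u)
  have "(\<lambda>v. word_tens [c] (b # v)) \<odot> A = (if b = c then A else (\<lambda>_. 0))"
  proof (cases "b = c")
    case True
    then have "(\<lambda>v. word_tens [c] (b # v)) = \<one>\<^sub>T"
      by (auto simp: word_tens_def tunit_def)
    then show ?thesis using True by simp
  qed (simp add: word_tens_def tmult_def)
  then show ?thesis
    using Cons by (simp add: tmult_Cons word_tens_def)
qed (simp add: word_tens_def)

lemma shuffle_eq_0: "length u \<noteq> length v + length w \<Longrightarrow> shuffle v w u = 0"
proof (induction v w arbitrary: u rule: shuffle.induct)
  case (3 a v b w)
  then show ?case
    by (cases u) (auto simp: tmult_word_tens_Cons)
qed (auto simp: word_tens_def)

text \<open>Left multiplication by a letter is adjoint to the shift; this turns the recursion of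
  \<open>shuffle\<close> into that of \<open>shuffle_pairing\<close>.\<close>

lemma level_inner_word_tens_Cons:
  fixes a A :: "'d::finite tens"
  shows "level_inner (Suc k) a (word_tens [c] \<odot> A) = level_inner k (\<lambda>u. a (c # u)) A"
proof -
  have "level_inner (Suc k) a (word_tens [c] \<odot> A) =
      (\<Sum>w\<in>(#) c ` {u. length u = k}. a w * (word_tens [c] \<odot> A) w)"
    unfolding level_inner_def
    by (rule sum.mono_neutral_right, rule finite_words_length)
      (auto simp: tmult_word_tens_Cons length_Suc_conv split: list.splits if_splits)
  also have "\<dots> = level_inner k (\<lambda>u. a (c # u)) A"
    unfolding level_inner_def
    by (subst sum.reindex) (auto simp: tmult_word_tens_Cons)
  finally show ?thesis .
qed

lemma level_inner_add_right: "level_inner k A (\<lambda>w. B w + C w) = level_inner k A B + level_inner k A C"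
  by (simp add: level_inner_def algebra_simps sum.distrib)

lemma tinner_shuffle: "tinner a (shuffle v w) = shuffle_pairing a v w"
proof -
  have "level_inner (length v + length w) a (shuffle v w) = shuffle_pairing a v w"
  proof (induction v w arbitrary: a rule: shuffle.induct)
    case (2 c v)
    show ?case
      using level_inner_word_tens[of "c # v" a] by simp
  next
    case (3 c v b w)
    then show ?case
      by (simp add: level_inner_add_right level_inner_word_tens_Cons)
  qed simp
  then show ?thesis
    using tinner_cong_level[of "length v + length w" "shuffle v w" a] by (simp add: shuffle_eq_0)
qed

lemma shuffle_pairing_lin:
  "shuffle_pairing (\<lambda>u. r * a u + b u) v w = r * shuffle_pairing a v w + shuffle_pairing b v w"
proof (induction a v w arbitrary: b rule: shuffle_pairing.induct)
  case (3 a c v d w)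
  show ?case
    using "3.IH"(1)[of "\<lambda>u. b (c # u)"] "3.IH"(2)[of "\<lambda>u. b (d # u)"]
    by (simp only: shuffle_pairing.simps distrib_left)
qed simp_all

lemma shuffle_pairing_cong:
  assumes "\<And>u. length u = length v + length w \<Longrightarrow> a u = b u"
  shows "shuffle_pairing a v w = shuffle_pairing b v w"
  using assms
proof (induction a v w arbitrary: b rule: shuffle_pairing.induct)
  case (1 a w)
  show ?case using "1.prems"[of w] by simp
next
  case (2 a c v)
  show ?case using "2.prems"[of "c # v"] by simp
next
  case (3 a c v d w)
  have "shuffle_pairing (\<lambda>u. a (c # u)) v (d # w) = shuffle_pairing (\<lambda>u. b (c # u)) v (d # w)"
    by (rule "3.IH"(1)) (rule "3.prems", simp)
  moreover have "shuffle_pairing (\<lambda>u. a (d # u)) (c # v) w = shuffle_pairing (\<lambda>u. b (d # u)) (c # v) w"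
    by (rule "3.IH"(2)) (rule "3.prems", simp)
  ultimately show ?case by simp
qed

text \<open>Deconcatenation is a homomorphism for the shuffle product.\<close>
lemma shuffle_pairing_tmult:
  "shuffle_pairing (A \<odot> B) v w =
    (\<Sum>i\<le>length v. \<Sum>j\<le>length w.
      shuffle_pairing A (take i v) (take j w) * shuffle_pairing B (drop i v) (drop j w))"
proof (induction A v w rule: shuffle_pairing.induct)
  case (1 a w)
  then show ?case by (simp add: tmult_def)
next
  case (2 a c v)
  then show ?case by (simp add: tmult_def)
next
  case (3 a c v b w)
  let ?S = shuffle_pairing
  let ?p = "\<lambda>A v' w' i j. ?S A (take i v') (take j w') * ?S B (drop i v') (drop j w')"
  let ?m = "length v" and ?k = "length w"
  have e: "(a \<odot> B) (d # u) = a [] * B (d # u) + ((\<lambda>u. a (d # u)) \<odot> B) u" for d u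
    by (rule tmult_Cons)
  have "?S (a \<odot> B) (c # v) (b # w) =
      a [] * ?S B (c # v) (b # w)
      + (\<Sum>i\<le>?m. \<Sum>j\<le>Suc ?k. ?p (\<lambda>u. a (c # u)) v (b # w) i j)
      + (\<Sum>i\<le>Suc ?m. \<Sum>j\<le>?k. ?p (\<lambda>u. a (b # u)) (c # v) w i j)"
    using 3 by (simp only: shuffle_pairing.simps e shuffle_pairing_lin) (simp add: algebra_simps)
  \<comment> \<open>Pairs of prefixes with one of them empty are split off: there the recursion of
    \<open>shuffle_pairing\<close> has a single branch. For two nonempty prefixes the remaining
    double sums are its two branches.\<close>
  also have "(\<Sum>i\<le>?m. \<Sum>j\<le>Suc ?k. ?p (\<lambda>u. a (c # u)) v (b # w) i j) =
      (\<Sum>i\<le>?m. ?p (\<lambda>u. a (c # u)) v (b # w) i 0)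
      + (\<Sum>i\<le>?m. \<Sum>j\<le>?k. ?p (\<lambda>u. a (c # u)) v (b # w) i (Suc j))"
    by (simp add: sum.atMost_Suc_shift sum.distrib del: sum.atMost_Suc)
  also have "(\<Sum>i\<le>Suc ?m. \<Sum>j\<le>?k. ?p (\<lambda>u. a (b # u)) (c # v) w i j) =
      (\<Sum>j\<le>?k. ?p (\<lambda>u. a (b # u)) (c # v) w 0 j)
      + (\<Sum>i\<le>?m. \<Sum>j\<le>?k. ?p (\<lambda>u. a (b # u)) (c # v) w (Suc i) j)"
    by (simp add: sum.atMost_Suc_shift sum.distrib del: sum.atMost_Suc)
  finally show ?case
    by (simp add: sum.atMost_Suc_shift sum.distrib algebra_simps del: sum.atMost_Suc)
qed

lemma sum_sum_origin:
  "(\<Sum>i\<le>m. \<Sum>j\<le>k. if i = 0 \<and> j = 0 then D else (0::real)) = D" for m k :: nat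
  by (simp add: sum.atMost_shift)

text \<open>Inductively on the total length, all summands but the one with empty prefixes vanish.\<close>
lemma infinitesimal_character:
  fixes A B :: "'d tens"
  assumes A: "\<And>v w. length v + length w \<le> n \<Longrightarrow> shuffle_pairing A v w = A v * A w"
    and AB: "\<And>v w. length v + length w \<le> n \<Longrightarrow>
      shuffle_pairing (A \<odot> B) v w = (A \<odot> B) v * A w + A v * (A \<odot> B) w"
    and A1: "A [] = 1"
    and len: "length v + length w \<le> n"
  shows "shuffle_pairing B v w = B v * \<one>\<^sub>T w + \<one>\<^sub>T v * B w"
proof -
  define d where "d v w = shuffle_pairing B v w - (B v * \<one>\<^sub>T w + \<one>\<^sub>T v * B w)" for v w
  have unit: "(\<Sum>i\<le>length u. A (take i u) * \<one>\<^sub>T (drop i u)) = A u" for u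
    using tmult_tunit[of A] by (simp add: tmult_def fun_eq_iff)
  have AB': "(\<Sum>i\<le>length u. A (take i u) * B (drop i u)) = (A \<odot> B) u" for u
    by (simp add: tmult_def)
  have "d v w = 0"
    using len
  proof (induction "length v + length w" arbitrary: v w rule: less_induct)
    case less
    let ?t = "\<lambda>i j. A (take i v) * A (take j w) * d (drop i v) (drop j w)"
    \<comment> \<open>The convolution of the defect \<open>d\<close> with the character
      \<open>A\<close> is the derivation rule assumed for \<open>A \<odot> B\<close>, written out by
      \<open>shuffle_pairing_tmult\<close>; hence it vanishes.\<close>
    have "(\<Sum>i\<le>length v. \<Sum>j\<le>length w. ?t i j) =
        shuffle_pairing (A \<odot> B) v w
        - (\<Sum>i\<le>length v. \<Sum>j\<le>length w. (A (take i v) * B (drop i v)) * (A (take j w) * \<one>\<^sub>T (drop j w)))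
        - (\<Sum>i\<le>length v. \<Sum>j\<le>length w. (A (take i v) * \<one>\<^sub>T (drop i v)) * (A (take j w) * B (drop j w)))"
      unfolding shuffle_pairing_tmult sum_subtractf[symmetric]
      by (intro sum.cong refl) (use A less.prems in \<open>simp add: d_def algebra_simps\<close>)
    also have "\<dots> = 0"
      unfolding sum_distrib_left[symmetric] sum_distrib_right[symmetric] unit AB'
      using AB[OF less.prems] by simp
    finally have 0: "(\<Sum>i\<le>length v. \<Sum>j\<le>length w. ?t i j) = 0" .
    have "(\<Sum>i\<le>length v. \<Sum>j\<le>length w. ?t i j) =
        (\<Sum>i\<le>length v. \<Sum>j\<le>length w. if i = 0 \<and> j = 0 then d v w else 0)"
    proof (intro sum.cong refl)
      fix i j assume ij: "i \<in> {..length v}" "j \<in> {..length w}"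
      show "?t i j = (if i = 0 \<and> j = 0 then d v w else 0)"
      proof (cases "i = 0 \<and> j = 0")
        case False
        then have "d (drop i v) (drop j w) = 0"
          using less.hyps[of "drop i v" "drop j w"] less.prems ij by auto
        then show ?thesis using False by auto
      qed (simp add: A1)
    qed
    also have "\<dots> = d v w"
      by (rule sum_sum_origin)
    finally show ?case
      unfolding 0 by (rule sym)
  qed
  then show ?thesis
    by (simp add: d_def)
qed

section \<open>The Dynkin operator\<close>

text \<open>A shuffle of a prefix of \<open>w\<close> with the reversed remainder starts with the
  first letter of \<open>w\<close>, coming from the prefix, or with its last letter, coming from the
  reversed suffix. Removing the first letter moves the cut by one, whence
  \<open>f (Suc i)\<close>.\<close>

lemma shuffle_pairing_rev_split:
  fixes f :: "nat \<Rightarrow> real"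
  defines "P \<equiv> \<lambda>a w i. shuffle_pairing a (take i w) (rev (drop i w))"
  assumes w: "w = c # w'" "w = w'' @ [d]"
  shows "(\<Sum>i\<le>length w. f i * P a w i) =
    (\<Sum>i\<le>length w'. f (Suc i) * P (\<lambda>u. a (c # u)) w' i)
    + (\<Sum>i\<le>length w''. f i * P (\<lambda>u. a (d # u)) w'' i)"
proof -
  let ?m = "length w'"
  have len: "length w'' = ?m" "length w = Suc ?m"
    using arg_cong[OF w(1), of length] arg_cong[OF w(2), of length] by auto
  \<comment> \<open>At the two extreme cuts one of the words is empty and only one branch survives;
    the conditionals record this.\<close>
  have P: "P a w i = (if i = 0 then 0 else P (\<lambda>u. a (c # u)) w' (i - 1))
      + (if i = Suc ?m then 0 else P (\<lambda>u. a (d # u)) w'' i)" if "i \<le> Suc ?m" for i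
  proof -
    have c: "take i w = c # take (i - 1) w'" "drop i w = drop (i - 1) w'" if "i \<noteq> 0"
      using that w(1) by (cases i; simp)+
    have d: "rev (drop i w) = d # rev (drop i w'')" "take i w = take i w''" if "i \<noteq> Suc ?m"
      using that \<open>i \<le> Suc ?m\<close> w(2) len by auto
    consider "i = 0" | "i = Suc ?m" | "i \<noteq> 0" "i \<noteq> Suc ?m" by blast
    then show ?thesis
    proof cases
      case 1
      then show ?thesis
        using d by (simp add: P_def)
    next
      case 2
      then show ?thesis
        using c len by (simp add: P_def)
    next
      case 3
      then have "d # rev (drop i w'') = rev (drop (i - 1) w')" "c # take (i - 1) w' = take i w''"
        using c d by simp_all
      moreover have "P a w i = shuffle_pairing (\<lambda>u. a (c # u)) (take (i - 1) w') (d # rev (drop i w''))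
          + shuffle_pairing (\<lambda>u. a (d # u)) (c # take (i - 1) w') (rev (drop i w''))"
        unfolding P_def c(1)[OF 3(1)] d(1)[OF 3(2)] by (rule shuffle_pairing.simps)
      ultimately show ?thesis
        using 3 by (simp add: P_def)
    qed
  qed
  have "(\<Sum>i\<le>length w. f i * P a w i) =
      (\<Sum>i\<le>Suc ?m. f i * (if i = 0 then 0 else P (\<lambda>u. a (c # u)) w' (i - 1)))
      + (\<Sum>i\<le>Suc ?m. f i * (if i = Suc ?m then 0 else P (\<lambda>u. a (d # u)) w'' i))"
    unfolding len sum.distrib[symmetric] by (intro sum.cong) (simp_all add: P distrib_left)
  also have "(\<Sum>i\<le>Suc ?m. f i * (if i = 0 then 0 else P (\<lambda>u. a (c # u)) w' (i - 1))) =
      (\<Sum>i\<le>?m. f (Suc i) * P (\<lambda>u. a (c # u)) w' i)"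
    by (simp add: sum.atMost_Suc_shift del: sum.atMost_Suc)
  also have "(\<Sum>i\<le>Suc ?m. f i * (if i = Suc ?m then 0 else P (\<lambda>u. a (d # u)) w'' i)) =
      (\<Sum>i\<le>?m. f i * P (\<lambda>u. a (d # u)) w'' i)"
    by simp
  finally show ?thesis
    by (simp add: len)
qed

text \<open>The antipode of the shuffle algebra reverses a word with sign, and its convolution with
  the identity is the counit. After the split, the two sums vanish by induction, or coincide when
  \<open>w\<close> is a single letter.\<close>

lemma antipode_sum_eq_0:
  assumes "w \<noteq> []"
  shows "(\<Sum>i\<le>length w. (-1) ^ (length w - i) * shuffle_pairing a (take i w) (rev (drop i w))) = 0"
  using assms
proof (induction "length w" arbitrary: a w)
  case (Suc m)
  obtain c w' where c: "w = c # w'" using Suc.prems by (cases w) auto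
  obtain d w'' where d: "w = w'' @ [d]" using Suc.prems by (cases w rule: rev_cases) auto
  have len: "length w' = m" "length w'' = m"
    using Suc.hyps(2) arg_cong[OF c, of length] arg_cong[OF d, of length] by auto
  let ?C = "\<lambda>a w. \<Sum>i\<le>m. (-1) ^ (m - i) * shuffle_pairing a (take i w) (rev (drop i w))"
  have sgn: "(\<Sum>i\<le>m. (-1) ^ (Suc m - i) * g i) = - (\<Sum>i\<le>m. (-1) ^ (m - i) * g i)" for g :: "nat \<Rightarrow> real"
    unfolding sum_negf[symmetric] by (intro sum.cong) (simp_all add: Suc_diff_le)
  have "(\<Sum>i\<le>length w. (-1) ^ (length w - i) * shuffle_pairing a (take i w) (rev (drop i w))) =
      ?C (\<lambda>u. a (c # u)) w' - ?C (\<lambda>u. a (d # u)) w''"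
    unfolding shuffle_pairing_rev_split[OF c d, of "\<lambda>i. (-1) ^ (length w - i)" a]
    by (simp add: len Suc.hyps(2)[symmetric] sgn)
  also have "\<dots> = 0"
  proof (cases m)
    case 0
    then show ?thesis using len c d by simp
  next
    case (Suc k)
    then have ne: "w' \<noteq> []" "w'' \<noteq> []" using len by auto
    show ?thesis
      using Suc.hyps(1)[of w' "\<lambda>u. a (c # u)"] Suc.hyps(1)[of w'' "\<lambda>u. a (d # u)"] len ne
      by simp
  qed
  finally show ?case .
qed simp

text \<open>The coefficients of the sum of \<open>a (i\<^sub>1\<dots>i\<^sub>k) [e_{i1}, [\<dots>, [e_{ik-1}, e_{ik}]]]\<close>.\<close>
function dynkin :: "'d tens \<Rightarrow> 'd list \<Rightarrow> real"
  where
    "dynkin a [] = 0"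
  | "dynkin a [c] = a [c]"
  | "dynkin a (c # d # u) = dynkin (\<lambda>v. a (c # v)) (d # u)
       - dynkin (\<lambda>v. a (last (d # u) # v)) (c # butlast (d # u))"
  by pat_completeness auto
termination
  by (relation "Wellfounded.measure (\<lambda>(a, w). length w)") auto

text \<open>Up to the shuffle pairing, the right-hand side is the convolution of the degree with the antipode.\<close>
lemma dynkin_eq:
  "dynkin a w = (\<Sum>i\<le>length w. (-1) ^ (length w - i) * real i * shuffle_pairing a (take i w) (rev (drop i w)))"
proof (induction a w rule: dynkin.induct)
  case (3 a c d u)
  let ?w = "c # d # u" and ?l = "last (d # u)" and ?w' = "d # u" and ?w'' = "c # butlast (d # u)"
  let ?m = "Suc (length u)"
  let ?a = "\<lambda>u. a (c # u)" and ?b = "\<lambda>u. a (?l # u)"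
  let ?P = "\<lambda>a w i. shuffle_pairing a (take i w) (rev (drop i w))"
  have w'': "?w = ?w'' @ [?l]" by simp
  have "(\<Sum>i\<le>length ?w. (-1) ^ (length ?w - i) * real i * ?P a ?w i) =
      (\<Sum>i\<le>?m. (-1) ^ (?m - i) * real (Suc i) * ?P ?a ?w' i)
      + (\<Sum>i\<le>?m. (-1) ^ (Suc ?m - i) * real i * ?P ?b ?w'' i)"
    using shuffle_pairing_rev_split[OF refl w'', of "\<lambda>i. (-1) ^ (length ?w - i) * real i" a]
    by simp
  \<comment> \<open>The shifted cut yields \<open>real i + 1\<close>; the surplus 1 contributes an
    antipode sum over the nonempty word \<open>?w'\<close>, which is zero.\<close>
  also have "(\<Sum>i\<le>?m. (-1) ^ (?m - i) * real (Suc i) * ?P ?a ?w' i) =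
      (\<Sum>i\<le>?m. (-1) ^ (?m - i) * real i * ?P ?a ?w' i) + (\<Sum>i\<le>?m. (-1) ^ (?m - i) * ?P ?a ?w' i)"
    unfolding sum.distrib[symmetric] by (intro sum.cong) (simp_all add: algebra_simps)
  also have "(\<Sum>i\<le>?m. (-1) ^ (?m - i) * ?P ?a ?w' i) = 0"
    using antipode_sum_eq_0[of ?w' ?a] by simp
  also have "(\<Sum>i\<le>?m. (-1) ^ (Suc ?m - i) * real i * ?P ?b ?w'' i) =
      - (\<Sum>i\<le>?m. (-1) ^ (?m - i) * real i * ?P ?b ?w'' i)"
    unfolding sum_negf[symmetric] by (intro sum.cong) (simp_all add: Suc_diff_le)
  finally have e: "(\<Sum>i\<le>length ?w. (-1) ^ (length ?w - i) * real i * ?P a ?w i) =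
      (\<Sum>i\<le>?m. (-1) ^ (?m - i) * real i * ?P ?a ?w' i)
      - (\<Sum>i\<le>?m. (-1) ^ (?m - i) * real i * ?P ?b ?w'' i)"
    by simp
  have l: "length ?w' = ?m" "length ?w'' = ?m" by simp_all
  show ?case
    unfolding e dynkin.simps(3) "3.IH" l ..
qed simp_all

section \<open>From the Dynkin operator to Lie elements\<close>

lemma sum_fun_apply: "(\<Sum>c\<in>I. F c) w = (\<Sum>c\<in>I. F c w)"
  by (induction I rule: infinite_finite_induct) auto

lemma tmult_word_tens_snoc:
  "(A \<odot> word_tens [c]) w = (if w \<noteq> [] \<and> last w = c then A (butlast w) else 0)"
proof (cases w rule: rev_cases)
  case (snoc u b)
  have "(\<lambda>p. word_tens [c] (p @ [b])) = (if b = c then \<one>\<^sub>T else (\<lambda>_. 0))"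
    by (auto simp: word_tens_def tunit_def)
  moreover have "A \<odot> (\<lambda>_. 0) = (\<lambda>_. 0)"
    by (simp add: tmult_def)
  ultimately show ?thesis
    using snoc by (auto simp: tmult_append word_tens_def)
qed (simp add: word_tens_def)

lemma lie_layer_scaleR: "a \<in> lie_layer k \<Longrightarrow> r *\<^sub>R a \<in> lie_layer k"
proof (cases k rule: lie_layer.cases)
  case (3 j)
  then show "a \<in> lie_layer k \<Longrightarrow> r *\<^sub>R a \<in> lie_layer k"
    by (simp only: lie_layer.simps(3) span_scale)
qed (auto simp: scaleR_fun_def)

text \<open>Read over all words at once, the recursion of \<open>dynkin\<close> is a sum over
  letters of the commutators of \<open>e_c\<close> with the Dynkin image of the shift of
  \<open>a\<close> by \<open>c\<close>, and each of these generates the next layer.\<close>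

lemma tlevel_dynkin_in_lie_layer:
  fixes a :: "'d::finite tens"
  shows "tlevel (Suc k) (dynkin a) \<in> lie_layer (Suc k)"
proof (induction k arbitrary: a)
  case 0
  then show ?case by (simp add: tlevel_def)
next
  case (Suc k)
  define L where "L c = tlevel (Suc k) (dynkin (\<lambda>v. a (c # v)))" for c
  let ?e = "\<lambda>c. word_tens [c] :: 'd tens"
  have "tlevel (Suc (Suc k)) (dynkin a) = (\<Sum>c\<in>UNIV. ?e c \<odot> L c - L c \<odot> ?e c)"
  proof
    fix w :: "'d list"
    show "tlevel (Suc (Suc k)) (dynkin a) w = (\<Sum>c\<in>UNIV. ?e c \<odot> L c - L c \<odot> ?e c) w"
    proof (cases "(a, w)" rule: dynkin.cases)
      case 1
      then show ?thesis
        by (simp add: sum_fun_apply tlevel_def tmult_word_tens_Cons tmult_word_tens_snoc)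
    next
      case (2 _ c)
      then show ?thesis
        by (auto simp: sum_fun_apply tlevel_def tmult_word_tens_Cons tmult_word_tens_snoc L_def
            intro!: sum.neutral)
    next
      case (3 _ c d u)
      moreover have "last (c # d # u) = last (d # u)" "butlast (c # d # u) = c # butlast (d # u)"
        by simp_all
      ultimately show ?thesis
        by (simp add: sum_fun_apply tlevel_def tmult_word_tens_Cons tmult_word_tens_snoc L_def
            sum_subtractf del: last.simps butlast.simps)
    qed
  qed
  moreover have "?e c \<odot> L c - L c \<odot> ?e c \<in> lie_layer (Suc (Suc k))" for c
  proof -
    have "?e c \<in> lie_layer (Suc 0)"
      by (auto simp: word_tens_def)
    moreover have "L c \<in> lie_layer (Suc k)"
      unfolding L_def by (rule Suc.IH)
    ultimately show ?thesis
      unfolding lie_layer.simps(3) by (intro span_base) blast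
  qed
  ultimately show ?case
    by (simp add: span_sum)
qed

text \<open>The Dynkin operator multiplies a primitive element of degree \<open>k\<close> by \<open>k\<close>.\<close>
lemma in_lie_algebra_if_primitive:
  fixes a :: "'d::finite tens"
  assumes a: "a \<in> trunc_space n" "a [] = 0"
    and sh: "\<And>v w. v \<noteq> [] \<Longrightarrow> w \<noteq> [] \<Longrightarrow> length v + length w \<le> n \<Longrightarrow> shuffle_pairing a v w = 0"
  shows "a \<in> lie_algebra n"
proof -
  have "tlevel k a \<in> lie_layer k" if "k \<le> n" for k
  proof (cases k)
    case 0
    then show ?thesis using a(2) by (auto simp: tlevel_def)
  next
    case (Suc m)
    have "dynkin a w = real k * a w" if "length w = k" for w
    proof -
      \<comment> \<open>The cut at 0 dies by the factor \<open>real i\<close>, an inner cut because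
        \<open>a\<close> vanishes on shuffles of two nonempty words.\<close>
      have "dynkin a w = (\<Sum>i\<le>k. if i = k then real k * a w else 0)"
        unfolding dynkin_eq that
      proof (intro sum.cong refl)
        fix i assume "i \<in> {..k}"
        then show "(- 1) ^ (k - i) * real i * shuffle_pairing a (take i w) (rev (drop i w)) =
            (if i = k then real k * a w else 0)"
          using sh[of "take i w" "rev (drop i w)"] \<open>k \<le> n\<close> that Suc
            by (cases "i = 0"; cases "i = k"; force)
      qed
      then show ?thesis by simp
    qed
    then have "tlevel k a = (1 / real k) *\<^sub>R tlevel k (dynkin a)"
      using Suc by (auto simp: tlevel_def scaleR_fun_def)
    then show ?thesis
      using lie_layer_scaleR[OF tlevel_dynkin_in_lie_layer[of m a]] Suc by simp
  qed
  then show ?thesis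
    using a by (simp add: lie_algebra_def)
qed

section \<open>Smooth rough paths and their diagonal derivative\<close>

lemma continuous_on_linv:
  assumes "\<And>w. continuous_on I (\<lambda>s. X s w)"
  shows "continuous_on I (\<lambda>s. linv (X s) w)"
proof (induction "length w" arbitrary: w rule: less_induct)
  case less
  show ?case
  proof (cases "w = []")
    case False
    have eq: "(\<lambda>s. linv (X s) w) = (\<lambda>s. - (\<Sum>i<length w. linv (X s) (take i w) * X s (drop i w)))"
      by (subst linv.simps) (simp add: False)
    have "continuous_on I (\<lambda>s. linv (X s) (take i w))" if "i < length w" for i
      by (rule less) (use that in simp)
    then show ?thesis
      unfolding eq by (auto intro!: continuous_intros assms)
  qed simp
qed

lemma has_real_derivative_shuffle_pairing:
  assumes "\<And>w. ((\<lambda>u. F u w) has_real_derivative D w) (at s within S)"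
  shows "((\<lambda>u. shuffle_pairing (F u) v w) has_real_derivative shuffle_pairing D v w) (at s within S)"
proof -
  have "((\<lambda>u. shuffle_pairing (F u) v w) has_real_derivative shuffle_pairing D v w) (at s within S)"
    if "\<forall>w. ((\<lambda>u. F u w) has_real_derivative D w) (at s within S)" for F D
    using that
  proof (induction D v w arbitrary: F rule: shuffle_pairing.induct)
    case (3 a c v d w)
    show ?case
      using DERIV_add[OF "3.IH"(1)[of "\<lambda>u w. F u (c # w)"] "3.IH"(2)[of "\<lambda>u w. F u (d # w)"]] "3.prems"
      by simp
  qed auto
  with assms show ?thesis by blast
qed

lemma has_real_derivative_tmult_right:
  assumes "\<And>w. ((\<lambda>u. F u w) has_real_derivative D w) (at s within S)"
  shows "((\<lambda>u. (A \<odot> F u) w) has_real_derivative (A \<odot> D) w) (at s within S)"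
  unfolding tmult_def by (intro DERIV_sum DERIV_cmult assms)

lemma has_real_derivative_ttrunc:
  assumes "\<And>w. ((\<lambda>u. F u w) has_real_derivative D w) (at s within S)"
  shows "((\<lambda>u. ttrunc n (F u) w) has_real_derivative ttrunc n D w) (at s within S)"
  using assms by (simp add: ttrunc_def)

lemma has_real_derivative_eq_on:
  assumes "(f has_real_derivative D) (at s within S)" "\<And>u. u \<in> S \<Longrightarrow> f u = g u" "s \<in> S"
  shows "(g has_real_derivative D) (at s within S)"
  using assms by (metis has_field_derivative_transform_within zero_less_one)

lemma has_real_derivative_unique_on_interval:
  fixes a b x :: real
  assumes "(f has_real_derivative D) (at x within {a..b})" "(g has_real_derivative E) (at x within {a..b})"
    and "\<And>u. u \<in> {a..b} \<Longrightarrow> f u = g u" "x \<in> {a..b}" "a < b"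
  shows "D = E"
  using has_real_derivative_eq_on[OF assms(1,3,4)] assms(2,4,5)
    vector_derivative_within_closed_interval[of a b x g]
  by (auto simp: has_real_derivative_iff_has_vector_derivative)

locale smooth_rough_path =
  fixes T :: real and n :: nat and X :: "real \<Rightarrow> 'd::finite tens"
  assumes T: "T > 0" and rough: "smooth_geometric_rough_path T n X"
begin

abbreviation "I \<equiv> {0..T}"
abbreviation "x \<equiv> diag_deriv T n X"

lemma X_trunc: "s \<in> I \<Longrightarrow> X s \<in> trunc_space n"
  using rough by (simp add: smooth_geometric_rough_path_def)

lemma X_shuffle:
  "s \<in> I \<Longrightarrow> length v + length w \<le> n \<Longrightarrow> shuffle_pairing (X s) v w = X s v * X s w"
  using rough by (simp add: smooth_geometric_rough_path_def tinner_shuffle)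

text \<open>Shuffling two empty words leaves the values 0 and 1. If it were 0, shuffling with the
  empty word would make every coordinate vanish, against \<open>X s \<noteq> 0\<close>.\<close>

lemma X_Nil [simp]:
  assumes s: "s \<in> I"
  shows "X s [] = 1"
proof (rule ccontr)
  assume "X s [] \<noteq> 1"
  then have "X s [] = 0"
    using X_shuffle[OF s, of "[]" "[]"] by simp
  then have "X s w = 0" for w
    using X_shuffle[OF s, of w "[]"] X_trunc[OF s] by (cases "length w \<le> n") (auto simp: trunc_space_def)
  then have "X s = 0" by auto
  then show False
    using rough s by (auto simp: smooth_geometric_rough_path_def)
qed

definition "dX s w = vector_derivative (\<lambda>u. X u w) (at s within I)"

lemma dX_eq:
  "((\<lambda>u. X u w) has_real_derivative D) (at s within I) \<Longrightarrow> s \<in> I \<Longrightarrow> dX s w = D"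
  unfolding dX_def has_real_derivative_iff_has_vector_derivative
  using T by (intro vector_derivative_within_closed_interval)

lemma dX: "s \<in> I \<Longrightarrow> ((\<lambda>u. X u w) has_real_derivative dX s w) (at s within I)"
  and dX_trunc: "s \<in> I \<Longrightarrow> n < length w \<Longrightarrow> dX s w = 0"
  and continuous_on_dX: "continuous_on I (\<lambda>s. dX s w)"
proof -
  \<comment> \<open>One witness serves all three claims: the first derivative \<open>G 1\<close>,
    continuous because it has a derivative itself, or 0 for long words, whose coordinates vanish on
    \<open>I\<close>.\<close>
  have "\<exists>g. (\<forall>s\<in>I. ((\<lambda>u. X u w) has_real_derivative g s) (at s within I)) \<and> continuous_on I g
    \<and> (n < length w \<longrightarrow> g = (\<lambda>_. 0))"
  proof (cases "length w \<le> n")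
    case True
    then have "smooth_on_interval T (\<lambda>t. X t w)"
      using rough by (simp add: smooth_geometric_rough_path_def)
    then obtain G where G0: "G 0 = (\<lambda>t. X t w)"
      and G: "\<forall>k. \<forall>t\<in>I. (G k has_real_derivative G (Suc k) t) (at t within I)"
      unfolding smooth_on_interval_def by (elim exE conjE)
    have "continuous_on I (G 1)"
      using G by (intro DERIV_continuous_on[of I "G 1" "G (Suc 1)"]) blast
    moreover have "\<forall>t\<in>I. ((\<lambda>u. X u w) has_real_derivative G 1 t) (at t within I)"
      using G[THEN spec, of 0] by (simp add: G0)
    ultimately show ?thesis
      using True by (intro exI[of _ "G 1"]) simp
  next
    case False
    have "((\<lambda>u. X u w) has_real_derivative 0) (at s within I)" if "s \<in> I" for s
      by (rule has_real_derivative_eq_on[of "\<lambda>_. 0"]) (use X_trunc False that in \<open>auto simp: trunc_space_def\<close>)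
    then show ?thesis by (intro exI[of _ "\<lambda>_. 0"]) simp
  qed
  then obtain g where g: "\<forall>s\<in>I. ((\<lambda>u. X u w) has_real_derivative g s) (at s within I)" "continuous_on I g"
    "n < length w \<longrightarrow> g = (\<lambda>_. 0)"
    by (elim exE conjE)
  have eq: "dX s w = g s" if "s \<in> I" for s
    using g(1) that by (intro dX_eq) auto
  show "s \<in> I \<Longrightarrow> ((\<lambda>u. X u w) has_real_derivative dX s w) (at s within I)"
    using g(1) by (simp add: eq)
  show "s \<in> I \<Longrightarrow> n < length w \<Longrightarrow> dX s w = 0"
    using g(3) by (simp add: eq)
  show "continuous_on I (\<lambda>s. dX s w)"
    using g(2) by (rule continuous_on_eq) (simp add: eq)
qed

lemma x_eq:
  assumes s: "s \<in> I"
  shows "x s = ttrunc n (linv (X s) \<odot> dX s)"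
proof
  fix w
  have "((\<lambda>v. increment n X s v w) has_real_derivative ttrunc n (linv (X s) \<odot> dX s) w) (at s within I)"
    unfolding increment_eq[of X, OF X_Nil[OF s]]
    by (intro has_real_derivative_ttrunc has_real_derivative_tmult_right dX s)
  then show "x s w = ttrunc n (linv (X s) \<odot> dX s) w"
    unfolding diag_deriv_def has_real_derivative_iff_has_vector_derivative
    using T s by (intro vector_derivative_within_closed_interval) auto
qed

lemma x_trunc: "s \<in> I \<Longrightarrow> x s \<in> trunc_space n"
  by (simp add: x_eq)

lemma X_has_derivative:
  assumes s: "s \<in> I"
  shows "((\<lambda>u. X u w) has_real_derivative ttrunc n (X s \<odot> x s) w) (at s within I)"
proof -
  have "ttrunc n (X s \<odot> x s) = ttrunc n (dX s)"
    using s by (simp add: x_eq tmult_assoc[symmetric] tmult_linv)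
  also have "\<dots> = dX s"
    using dX_trunc[OF s] by (intro ttrunc_id) (simp add: trunc_space_def)
  finally show ?thesis
    using dX[OF s] by simp
qed

lemma continuous_on_x: "continuous_on I (\<lambda>s. x s w)"
proof -
  have "continuous_on I (\<lambda>s. X s w)" for w
    using dX by (rule DERIV_continuous_on)
  then have "continuous_on I (\<lambda>s. ttrunc n (linv (X s) \<odot> dX s) w)"
    unfolding ttrunc_def tmult_def
    by (cases "length w \<le> n") (auto intro!: continuous_intros continuous_on_dX continuous_on_linv)
  then show ?thesis
    by (rule continuous_on_eq) (simp add: x_eq)
qed

text \<open>Differentiating the character identity along \<open>X' = X \<odot> x\<close> gives a
  derivation rule for \<open>X s \<odot> x s\<close>. Truncation does not interfere, since the total
  length stays within \<open>n\<close>.\<close>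

lemma x_primitive:
  assumes s: "s \<in> I" and len: "length v + length w \<le> n"
  shows "shuffle_pairing (x s) v w = x s v * \<one>\<^sub>T w + \<one>\<^sub>T v * x s w"
proof (rule infinitesimal_character[of n "X s"])
  fix v w :: "'d list" assume len: "length v + length w \<le> n"
  have "shuffle_pairing (ttrunc n (X s \<odot> x s)) v w =
      ttrunc n (X s \<odot> x s) v * X s w + ttrunc n (X s \<odot> x s) w * X s v"
  proof (rule has_real_derivative_unique_on_interval)
    show "((\<lambda>u. shuffle_pairing (X u) v w) has_real_derivative
        shuffle_pairing (ttrunc n (X s \<odot> x s)) v w) (at s within I)"
      by (intro has_real_derivative_shuffle_pairing X_has_derivative s)
    show "((\<lambda>u. X u v * X u w) has_real_derivative
        ttrunc n (X s \<odot> x s) v * X s w + ttrunc n (X s \<odot> x s) w * X s v) (at s within I)"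
      by (intro DERIV_mult X_has_derivative s)
  qed (use X_shuffle len s T in auto)
  moreover have "shuffle_pairing (ttrunc n (X s \<odot> x s)) v w = shuffle_pairing (X s \<odot> x s) v w"
    by (rule shuffle_pairing_cong) (use len in \<open>simp add: ttrunc_def\<close>)
  ultimately show "shuffle_pairing (X s \<odot> x s) v w = (X s \<odot> x s) v * X s w + X s v * (X s \<odot> x s) w"
    using len by (simp add: ttrunc_def mult.commute)
qed (use s len X_shuffle in auto)

text \<open>On two empty words primitivity says that the scalar part equals twice itself.\<close>

lemma x_Nil [simp]: "s \<in> I \<Longrightarrow> x s [] = 0"
  using x_primitive[of s "[]" "[]"] by (simp add: tunit_def)

lemma x_in_lie_algebra: "s \<in> I \<Longrightarrow> x s \<in> lie_algebra n"
  by (rule in_lie_algebra_if_primitive) (simp_all add: x_trunc x_primitive tunit_def)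

lemma increment_self: "increment n X 0 0 = \<one>\<^sub>T"
  using T by (simp add: increment_eq linv_tmult)

lemma increment_has_derivative:
  assumes s: "s \<in> I"
  shows "((\<lambda>u. increment n X 0 u w) has_real_derivative
    ttrunc n (increment n X 0 s \<odot> x s) w) (at s within I)"
proof -
  have 0: "X 0 [] = 1" using T by simp
  have "((\<lambda>u. increment n X 0 u w) has_real_derivative
      ttrunc n (linv (X 0) \<odot> ttrunc n (X s \<odot> x s)) w) (at s within I)"
    unfolding increment_eq[of X, OF 0]
    by (intro has_real_derivative_ttrunc has_real_derivative_tmult_right X_has_derivative s)
  then show ?thesis
    by (simp add: increment_eq[of X, OF 0] tmult_assoc)
qed

end

section \<open>Adjoints\<close>

lemma sum_words_append:
  "(\<Sum>w | length w = j + m. g w) = (\<Sum>u | length u = j. \<Sum>v | length v = m. g (u @ v))"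
  for g :: "'d::finite list \<Rightarrow> real"
  unfolding sum.cartesian_product
  by (rule sum.reindex_bij_witness[of _ "\<lambda>(u, v). u @ v" "\<lambda>w. (take j w, drop j w)"]) auto

lemma level_inner_commute: "level_inner k A B = level_inner k B A"
  by (simp add: level_inner_def mult.commute)

lemma tinner_commute: "tinner A B = tinner B A"
  by (simp add: tinner_def level_inner_commute)

text \<open>Grouping words by the cut gives a Cauchy product over degrees, the form that
  \<open>sums_tinner_finitary\<close> can sum.\<close>

lemma level_inner_tmult_right_factor:
  fixes A B c :: "'d::finite tens"
  shows "level_inner k B (c \<odot> A) =
    (\<Sum>j\<le>k. \<Sum>u | length u = j. c u * level_inner (k - j) A (\<lambda>v. B (u @ v)))"
proof -
  have "level_inner k B (c \<odot> A) = (\<Sum>w | length w = k. \<Sum>j\<le>k. B w * (c (take j w) * A (drop j w)))"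
    unfolding level_inner_def tmult_def by (intro sum.cong) (auto simp: sum_distrib_left)
  also have "\<dots> = (\<Sum>j\<le>k. \<Sum>w | length w = k. B w * (c (take j w) * A (drop j w)))"
    by (rule sum.swap)
  also have "\<dots> = (\<Sum>j\<le>k. \<Sum>u | length u = j. \<Sum>v | length v = k - j. B (u @ v) * (c u * A v))"
  proof (rule sum.cong[OF refl])
    fix j assume "j \<in> {..k}"
    then show "(\<Sum>w | length w = k. B w * (c (take j w) * A (drop j w))) =
        (\<Sum>u | length u = j. \<Sum>v | length v = k - j. B (u @ v) * (c u * A v))"
      using sum_words_append[where j = j and m = "k - j" and g = "\<lambda>w. B w * (c (take j w) * A (drop j w))"] by simp
  qed
  also have "\<dots> = (\<Sum>j\<le>k. \<Sum>u | length u = j. c u * level_inner (k - j) A (\<lambda>v. B (u @ v)))"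
    unfolding level_inner_def sum_distrib_left by (intro sum.cong refl) (simp add: algebra_simps)
  finally show ?thesis .
qed

lemma level_inner_tmult_left_factor:
  fixes A B c :: "'d::finite tens"
  shows "level_inner k B (A \<odot> c) =
    (\<Sum>j\<le>k. \<Sum>u | length u = j. c u * level_inner (k - j) A (\<lambda>v. B (v @ u)))"
proof -
  have "level_inner k B (A \<odot> c) =
      (\<Sum>j\<le>k. \<Sum>u | length u = j. \<Sum>v | length v = k - j. c v * (A u * B (u @ v)))"
    unfolding level_inner_tmult_right_factor
    unfolding level_inner_def sum_distrib_left
    by (intro sum.cong refl) (simp add: algebra_simps)
  also have "\<dots> = (\<Sum>j\<le>k. \<Sum>u | length u = k - j. \<Sum>v | length v = j. c v * (A u * B (u @ v)))"
    by (rule sum.reindex_bij_witness[of _ "\<lambda>j. k - j" "\<lambda>j. k - j"]) auto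
  also have "\<dots> = (\<Sum>j\<le>k. \<Sum>u | length u = j. c u * level_inner (k - j) A (\<lambda>v. B (v @ u)))"
    unfolding level_inner_def sum_distrib_left by (subst sum.swap) simp
  finally show ?thesis .
qed

lemma sums_shift_if:
  fixes h :: "nat \<Rightarrow> real"
  assumes "h sums s"
  shows "(\<lambda>k. if j \<le> k then h (k - j) else 0) sums s"
  using sums_iff_shift'[of "\<lambda>k. if j \<le> k then h (k - j) else 0" j s] assms by simp

lemma tinner_finitary:
  assumes "c \<in> trunc_space N"
  shows "tinner A c = (\<Sum>j\<le>N. level_inner j A c)"
  unfolding tinner_def
  by (rule suminf_finite) (use assms in \<open>auto simp: level_inner_def trunc_space_def\<close>)

text \<open>Both adjoints arise from a Cauchy product with a finitary factor.\<close>
lemma sums_tinner_finitary: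
  fixes c :: "'d::finite tens"
  assumes c: "c \<in> trunc_space N"
    and h: "\<And>u. h u sums D u"
    and L: "\<And>k. L k = (\<Sum>j\<le>k. \<Sum>u | length u = j. c u * h u (k - j))"
  shows "L sums tinner D c"
proof -
  \<comment> \<open>Extending by zero makes the range of \<open>j\<close> independent of
    \<open>k\<close>; \<open>c\<close> then confines it to \<open>j \<le> N\<close>, leaving
    finitely many shifted series.\<close>
  let ?g = "\<lambda>j k. if j \<le> k then \<Sum>u | length u = j. c u * h u (k - j) else 0"
  have "L = (\<lambda>k. \<Sum>j\<le>N. ?g j k)"
  proof
    fix k
    have "L k = (\<Sum>j\<le>k. ?g j k)"
      by (simp add: L)
    also have "\<dots> = (\<Sum>j\<le>max k N. ?g j k)"
      by (rule sum.mono_neutral_left) auto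
    also have "\<dots> = (\<Sum>j\<le>N. ?g j k)"
      by (rule sum.mono_neutral_right) (use c in \<open>auto simp: trunc_space_def\<close>)
    finally show "L k = (\<Sum>j\<le>N. ?g j k)" .
  qed
  moreover have "?g j sums (\<Sum>u | length u = j. c u * D u)" for j
    by (intro sums_shift_if[of "\<lambda>k. \<Sum>u | length u = j. c u * h u k"] sums_sum sums_mult h)
  then have "(\<lambda>k. \<Sum>j\<le>N. ?g j k) sums (\<Sum>j\<le>N. \<Sum>u | length u = j. c u * D u)"
    by (intro sums_sum)
  moreover have "(\<Sum>j\<le>N. \<Sum>u | length u = j. c u * D u) = tinner D c"
    unfolding tinner_finitary[OF c] level_inner_def by (simp add: mult.commute)
  ultimately show ?thesis
    by simp
qed

lemma finitary_word_tens: "finitary (word_tens w)"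
  unfolding finitary_def trunc_space_def word_tens_def by (intro exI[of _ "length w"]) auto

text \<open>Testing an adjoint against the word \<open>u\<close> forces this formula; by
  finitariness of \<open>c\<close>, convergence for each \<open>u\<close> separately is
  enough.\<close>

lemma is_left_adjI:
  assumes "\<And>u. summable (\<lambda>k. level_inner k A (\<lambda>v. B (v @ u)))"
  shows "is_left_adj A B (\<lambda>u. tinner A (\<lambda>v. B (v @ u)))"
  unfolding is_left_adj_def finitary_def
  using sums_tinner_finitary[of _ _ "\<lambda>u k. level_inner k A (\<lambda>v. B (v @ u))"
      "\<lambda>u. tinner A (\<lambda>v. B (v @ u))", OF _ _ level_inner_tmult_left_factor]
    assms summable_sums unfolding tinner_def by blast

lemma is_right_adjI:
  assumes "\<And>u. summable (\<lambda>k. level_inner k A (\<lambda>v. B (u @ v)))"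
  shows "is_right_adj A B (\<lambda>u. tinner A (\<lambda>v. B (u @ v)))"
  unfolding is_right_adj_def finitary_def
  using sums_tinner_finitary[of _ _ "\<lambda>u k. level_inner k A (\<lambda>v. B (u @ v))"
      "\<lambda>u. tinner A (\<lambda>v. B (u @ v))", OF _ _ level_inner_tmult_right_factor]
    assms summable_sums unfolding tinner_def by blast

lemma is_left_adj_unique:
  assumes "is_left_adj A B D" "is_left_adj A B E"
  shows "D = E"
proof
  fix w
  have "tinner D (word_tens w) = tinner E (word_tens w)"
    using assms finitary_word_tens unfolding is_left_adj_def by (meson sums_unique2)
  then show "D w = E w" by simp
qed

lemma is_right_adj_unique:
  assumes "is_right_adj A B D" "is_right_adj A B E"
  shows "D = E"
proof
  fix w
  have "tinner D (word_tens w) = tinner E (word_tens w)"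
    using assms finitary_word_tens unfolding is_right_adj_def by (meson sums_unique2)
  then show "D w = E w" by simp
qed

lemma left_adj_eq:
  assumes "\<And>u. summable (\<lambda>k. level_inner k A (\<lambda>v. B (v @ u)))"
  shows "left_adj A B = (\<lambda>u. tinner A (\<lambda>v. B (v @ u)))"
  unfolding left_adj_def 
  by (rule the_equality, rule is_left_adjI[OF assms])
    (rule is_left_adj_unique[OF _ is_left_adjI[OF assms]])

lemma right_adj_eq:
  assumes "\<And>u. summable (\<lambda>k. level_inner k A (\<lambda>v. B (u @ v)))"
  shows "right_adj A B = (\<lambda>u. tinner A (\<lambda>v. B (u @ v)))"
  unfolding right_adj_def 
  by (rule the_equality, rule is_right_adjI[OF assms])
    (rule is_right_adj_unique[OF _ is_right_adjI[OF assms]])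

lemma sums_level_inner_left_adj:
  assumes "\<And>u. summable (\<lambda>k. level_inner k A (\<lambda>v. B (v @ u)))" "c \<in> trunc_space N"
  shows "(\<lambda>k. level_inner k B (A \<odot> c)) sums tinner (\<lambda>u. tinner A (\<lambda>v. B (v @ u))) c"
  using is_left_adjI[OF assms(1)] assms(2) unfolding is_left_adj_def finitary_def by blast

lemma summable_level_inner_trunc:
  "B \<in> trunc_space N \<Longrightarrow> summable (\<lambda>k. level_inner k A B)"
  by (rule summable_finite[of "{..N}"]) (auto simp: level_inner_def trunc_space_def)

lemma tinner_left_adj_trunc:
  assumes "b \<in> trunc_space m" "c \<in> trunc_space N"
  shows "tinner (left_adj A b) c = tinner b (A \<odot> c)"
proof -
  have "summable (\<lambda>k. level_inner k A (\<lambda>v. b (v @ u)))" for u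
    by (rule summable_level_inner_trunc[of _ m]) (use assms(1) in \<open>simp add: trunc_space_def\<close>)
  then show ?thesis
    using sums_level_inner_left_adj[of A b c N] assms(2)
    by (simp add: left_adj_eq tinner_def[of b] sums_iff)
qed

lemma tinner_right_adj_trunc:
  assumes "b \<in> trunc_space m" "c \<in> trunc_space N"
  shows "tinner (right_adj A b) c = tinner b (c \<odot> A)"
proof -
  have "summable (\<lambda>k. level_inner k A (\<lambda>v. b (u @ v)))" for u
    by (rule summable_level_inner_trunc[of _ m]) (use assms(1) in \<open>simp add: trunc_space_def\<close>)
  then have "is_right_adj A b (right_adj A b)"
    using is_right_adjI[of A b] by (simp add: right_adj_eq)
  then show ?thesis
    using assms(2) unfolding is_right_adj_def finitary_def tinner_def[of b] by (metis sums_unique)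
qed

lemma left_adj_trunc:
  assumes "b \<in> trunc_space m"
  shows "left_adj A b u = tinner A (\<lambda>v. b (v @ u))"
  by (subst left_adj_eq, rule summable_level_inner_trunc[of _ m])
    (use assms in \<open>simp_all add: trunc_space_def\<close>)

section \<open>The algebraic identities behind the system\<close>

lemma tinner_cong_trunc:
  assumes c: "c \<in> trunc_space n" and "\<And>u. length u \<le> n \<Longrightarrow> A u = B u"
  shows "tinner A c = tinner B c"
  unfolding tinner_finitary[OF c] level_inner_def by (intro sum.cong refl) (use assms(2) in auto)

lemma tinner_lin_trunc:
  assumes c: "c \<in> trunc_space n"
  shows "tinner (\<lambda>u. r * A u + B u) c = r * tinner A c + tinner B c"
  unfolding tinner_finitary[OF c] level_inner_def
  by (simp add: algebra_simps sum.distrib sum_distrib_left)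

text \<open>
  The part of \<open>x\<close> falling on \<open>v\<close> is moved to the other argument by adjointness, the part falling on
  \<open>w\<close> stays; \<open>f\<close> is the overlap of the two.
\<close>
lemma tinner_tmult_append:
  fixes A B x :: "'d::finite tens" and n :: nat
  defines "f \<equiv> tinner A B"
  defines "\<phi> \<equiv> ttrunc n ((\<lambda>u. tinner B (\<lambda>v. A (v @ u))) - f *\<^sub>R \<one>\<^sub>T)"
    and "\<psi> \<equiv> ttrunc n ((\<lambda>u. tinner A (\<lambda>v. B (v @ u))) - f *\<^sub>R \<one>\<^sub>T)"
  assumes AB: "\<And>u. summable (\<lambda>k. level_inner k A (\<lambda>v. B (v @ u)))"
    and BA: "\<And>u. summable (\<lambda>k. level_inner k B (\<lambda>v. A (v @ u)))"
    and x: "x \<in> trunc_space n" "x [] = 0" and w: "length w \<le> n"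
  shows "tinner B (\<lambda>v. (A \<odot> x) (v @ w)) = f * x w + (\<phi> \<odot> x) w + left_adj \<psi> x w"
proof -
  let ?xw = "\<lambda>p. x (p @ w)"
  let ?LA = "\<lambda>u. tinner A (\<lambda>v. B (v @ u))" and ?LB = "\<lambda>u. tinner B (\<lambda>v. A (v @ u))"
  have xw: "?xw \<in> trunc_space n"
    using x by (simp add: trunc_space_def)
  have "level_inner k B (\<lambda>v. (A \<odot> x) (v @ w)) =
      level_inner k B (A \<odot> ?xw)
      + (\<Sum>i=1..length w. x (drop i w) * level_inner k B (\<lambda>v. A (v @ take i w)))" for k
    unfolding level_inner_def tmult_append distrib_left sum.distrib sum_distrib_left
    by (subst (2) sum.swap) (simp add: algebra_simps)
  moreover have "(\<lambda>k. level_inner k B (A \<odot> ?xw)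
      + (\<Sum>i=1..length w. x (drop i w) * level_inner k B (\<lambda>v. A (v @ take i w))))
    sums (tinner ?LA ?xw + (\<Sum>i=1..length w. x (drop i w) * ?LB (take i w)))"
    by (intro sums_add sums_sum sums_mult sums_level_inner_left_adj[OF AB xw])
      (use BA in \<open>simp add: tinner_def summable_sums\<close>)
  ultimately have "tinner B (\<lambda>v. (A \<odot> x) (v @ w)) =
      tinner ?LA ?xw + (\<Sum>i=1..length w. x (drop i w) * ?LB (take i w))"
    unfolding tinner_def[of B "\<lambda>v. (A \<odot> x) (v @ w)"] by (simp add: sums_iff)
  moreover have "tinner ?LA ?xw = f * x w + left_adj \<psi> x w"
  proof -
    \<comment> \<open>Adding back the multiple of the unit recovers the adjoint in degrees up to
      \<open>n\<close>, and \<open>?xw\<close> sees no others.\<close>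
    have "tinner ?LA ?xw = tinner (\<lambda>u. f * \<one>\<^sub>T u + \<psi> u) ?xw"
      by (rule tinner_cong_trunc[OF xw]) (simp add: \<psi>_def ttrunc_def scaleR_fun_def)
    then show ?thesis
      by (simp add: tinner_lin_trunc[OF xw] tinner_commute[of "\<one>\<^sub>T" ?xw] tinner_tunit left_adj_trunc[OF x(1)])
  qed
  moreover have "(\<Sum>i=1..length w. x (drop i w) * ?LB (take i w)) = (\<phi> \<odot> x) w"
  proof -
    \<comment> \<open>Thus the cut with empty prefix contributes nothing to
      \<open>\<phi> \<odot> x\<close>, matching the sum that starts at 1; on nonempty prefixes the
      subtracted unit is invisible.\<close>
    have "\<phi> [] = 0"
      by (simp add: \<phi>_def ttrunc_def scaleR_fun_def tunit_def f_def tinner_commute)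
    then have "(\<phi> \<odot> x) w = (\<Sum>i=1..length w. \<phi> (take i w) * x (drop i w))"
      unfolding tmult_def by (intro sum.mono_neutral_right) (auto simp: not_less_eq_eq Suc_le_eq)
    also have "\<dots> = (\<Sum>i=1..length w. x (drop i w) * ?LB (take i w))"
      using w by (intro sum.cong refl) (auto simp: \<phi>_def ttrunc_def scaleR_fun_def tunit_def)
    finally show ?thesis by simp
  qed
  ultimately show ?thesis by simp
qed

text \<open>Adjointness moves \<open>B\<close> to the other side, where
  \<open>tinner_tmult_append\<close> applies. Of the resulting terms, the pairing of
  \<open>left_adj \<psi> x\<close> with \<open>y\<close> is that of \<open>x\<close> with
  \<open>\<psi> \<odot> y\<close>, hence that of \<open>\<psi>\<close> with
  \<open>right_adj y x\<close>.\<close>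

lemma tinner_tmult_tmult:
  fixes A B x :: "'d::finite tens" and n :: nat
  defines "f \<equiv> tinner A B"
  defines "\<phi> \<equiv> ttrunc n ((\<lambda>u. tinner B (\<lambda>v. A (v @ u))) - f *\<^sub>R \<one>\<^sub>T)"
    and "\<psi> \<equiv> ttrunc n ((\<lambda>u. tinner A (\<lambda>v. B (v @ u))) - f *\<^sub>R \<one>\<^sub>T)"
  assumes AB: "\<And>u. summable (\<lambda>k. level_inner k A (\<lambda>v. B (v @ u)))"
    and BA: "\<And>u. summable (\<lambda>k. level_inner k B (\<lambda>v. A (v @ u)))"
    and BAx: "\<And>u. summable (\<lambda>k. level_inner k B (\<lambda>v. (A \<odot> x) (v @ u)))"
    and x: "x \<in> trunc_space n" "x [] = 0" and y: "y \<in> trunc_space n"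
  shows "tinner (A \<odot> x) (B \<odot> y) =
    tinner x y * f + tinner \<phi> (right_adj x y) + tinner \<psi> (right_adj y x)"
proof -
  have trunc: "\<phi> \<in> trunc_space n" "\<psi> \<in> trunc_space n"
    by (simp_all add: \<phi>_def \<psi>_def)
  have "tinner (A \<odot> x) (B \<odot> y) = tinner (\<lambda>u. tinner B (\<lambda>v. (A \<odot> x) (v @ u))) y"
    using sums_level_inner_left_adj[of B "A \<odot> x", OF BAx y]
    unfolding tinner_def[of "A \<odot> x"] by (simp add: sums_iff)
  also have "\<dots> = tinner (\<lambda>u. f * x u + (1 * (\<phi> \<odot> x) u + left_adj \<psi> x u)) y"
    by (rule tinner_cong_trunc[OF y])
      (use tinner_tmult_append[OF AB BA x] in \<open>simp add: f_def \<phi>_def \<psi>_def\<close>)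
  also have "\<dots> = f * tinner x y + (tinner (\<phi> \<odot> x) y + tinner (left_adj \<psi> x) y)"
    unfolding tinner_lin_trunc[OF y] by simp
  also have "tinner (\<phi> \<odot> x) y = tinner \<phi> (right_adj x y)"
    using tinner_right_adj_trunc[OF y trunc(1), of x] by (simp add: tinner_commute)
  also have "tinner (left_adj \<psi> x) y = tinner \<psi> (right_adj y x)"
    using tinner_left_adj_trunc[OF x(1) y, of \<psi>] tinner_right_adj_trunc[OF x(1) trunc(2), of y]
    by (simp add: tinner_commute)
  finally show ?thesis by simp
qed

section \<open>Geometric decay\<close>

text \<open>
  With this ratio the pairing of level \<open>k\<close>, which has \<open>CARD('d) ^ k\<close> words, is of order
  \<open>1 / 2 ^ k\<close>, even against a tensor that is merely bounded.
\<close>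
definition decays :: "real \<Rightarrow> 'd::finite tens \<Rightarrow> bool"
  where "decays C A \<longleftrightarrow> (\<forall>w. \<bar>A w\<bar> \<le> C * (1 / (2 * real CARD('d))) ^ length w)"

lemma decays_mono: "decays C A \<Longrightarrow> C \<le> C' \<Longrightarrow> decays C' A"
  unfolding decays_def by (auto intro: order_trans mult_right_mono)

lemma decays_nonneg: "decays C A \<Longrightarrow> 0 \<le> C"
  unfolding decays_def by (drule spec[of _ "[]"]) simp

lemma decays_bounded:
  fixes A :: "'d::finite tens"
  assumes "decays C A"
  shows "\<bar>A w\<bar> \<le> C"
proof -
  let ?q = "1 / (2 * real CARD('d))"
  have "1 \<le> 2 * real CARD('d)"
    using zero_less_card_finite[where 'a = 'd] by linarith
  then have "?q ^ length w \<le> 1"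
    by (intro power_le_one) (simp_all add: divide_le_eq)
  then have "C * ?q ^ length w \<le> C * 1"
    using decays_nonneg[OF assms] by (rule mult_left_mono)
  moreover have "\<bar>A w\<bar> \<le> C * ?q ^ length w"
    using assms by (simp only: decays_def)
  ultimately show ?thesis by simp
qed

lemma card_words: "card {w :: 'd::finite list. length w = k} = CARD('d) ^ k"
  using card_lists_length_eq[of "UNIV :: 'd set" k] by simp

lemma level_inner_le:
  fixes A B :: "'d::finite tens"
  assumes A: "decays C A" and B: "\<And>w. \<bar>B w\<bar> \<le> M"
  shows "\<bar>level_inner k A B\<bar> \<le> C * M * (1 / 2) ^ k"
proof -
  let ?q = "1 / (2 * real CARD('d))"
  have M: "0 \<le> M" using B[of "[]"] by simp
  have "\<bar>level_inner k A B\<bar> \<le> (\<Sum>w :: 'd list | length w = k. \<bar>A w * B w\<bar>)"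
    unfolding level_inner_def by (rule sum_abs)
  also have "\<dots> \<le> real (card {w :: 'd list. length w = k}) * (C * ?q ^ k * M)"
  proof (rule sum_bounded_above)
    fix w :: "'d list" assume "w \<in> {w. length w = k}"
    then have "\<bar>A w\<bar> \<le> C * ?q ^ k"
      using A unfolding decays_def by blast
    then show "\<bar>A w * B w\<bar> \<le> C * ?q ^ k * M"
      unfolding abs_mult using decays_nonneg[OF A] by (intro mult_mono B) auto
  qed
  also have "\<dots> = C * M * (real CARD('d) * ?q) ^ k"
    by (simp add: card_words power_mult_distrib power_divide)
  also have "real CARD('d) * ?q = 1 / 2"
    by simp
  finally show ?thesis .
qed

lemma summable_half: "summable (\<lambda>k. c * (1 / 2 :: real) ^ k)"
  by (intro summable_mult summable_geometric) simp

lemma summable_level_inner: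
  assumes "decays C A" "\<And>w. \<bar>B w\<bar> \<le> M"
  shows "summable (\<lambda>k. level_inner k A B)"
  using level_inner_le[OF assms]
  by (intro summable_comparison_test'[OF summable_half[of "C * M"], of 0]) simp

text \<open>The bound \<open>M\<close> does not depend on \<open>u\<close>, so
  \<open>level_inner_le\<close> gives a Weierstrass majorant for the differentiated series and
  termwise differentiation is allowed.\<close>

lemma has_real_derivative_tinner:
  fixes B :: "'d::finite tens" and F D :: "real \<Rightarrow> 'd tens"
  assumes "convex I" "s \<in> I" and B: "decays C B"
    and F: "\<And>u w. u \<in> I \<Longrightarrow> ((\<lambda>u. F u w) has_real_derivative D u w) (at u within I)"
    and FM: "\<And>u w. u \<in> I \<Longrightarrow> \<bar>F u w\<bar> \<le> M" and DM: "\<And>u w. u \<in> I \<Longrightarrow> \<bar>D u w\<bar> \<le> M"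
  shows "((\<lambda>u. tinner B (F u)) has_real_derivative tinner B (D s)) (at s within I)"
proof -
  have "uniform_limit I (\<lambda>k u. \<Sum>i<k. level_inner i B (D u)) (\<lambda>u. tinner B (D u)) sequentially"
    unfolding tinner_def using level_inner_le[OF B DM]
    by (intro Weierstrass_m_test[OF _ summable_half[of "C * M"]]) simp
  moreover have "((\<lambda>u. level_inner k B (F u)) has_real_derivative level_inner k B (D u)) (at u within I)"
    if "u \<in> I" for k u
    unfolding level_inner_def by (intro DERIV_sum DERIV_cmult F that)
  ultimately have "\<exists>g. \<forall>u\<in>I. (\<lambda>k. level_inner k B (F u)) sums g u \<and>
      (g has_real_derivative tinner B (D u)) (at u within I)"
    using assms(1,2) summable_level_inner[OF B FM[OF assms(2)]]
    by (intro has_field_derivative_series[where ?x0.0 = s])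
  then obtain g where g: "\<forall>u\<in>I. (\<lambda>k. level_inner k B (F u)) sums g u \<and>
      (g has_real_derivative tinner B (D u)) (at u within I)" ..
  have "(g has_real_derivative tinner B (D s)) (at s within I)"
    using g assms(2) by blast
  then show ?thesis
    by (rule has_real_derivative_eq_on) (use g assms(2) in \<open>auto simp: tinner_def sums_iff\<close>)
qed

text \<open>Since \<open>x\<close> lives in degrees 1 to \<open>n\<close>, at most \<open>n\<close>
  cuts contribute, and each loses at most \<open>n\<close> letters of decay, which costs
  \<open>(2 * CARD('d)) ^ n\<close>. Decay of \<open>A\<close> is required on shorter words only, as
  the induction in \<open>S_decays\<close> needs.\<close>

lemma tmult_le:
  fixes A x :: "'d::finite tens"
  assumes x: "x \<in> trunc_space n" "x [] = 0" and xM: "\<And>u. \<bar>x u\<bar> \<le> M"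
    and A: "\<And>v. length v < length w \<Longrightarrow> \<bar>A v\<bar> \<le> C * (1 / (2 * real CARD('d))) ^ length v"
    and C: "0 \<le> C"
  shows "\<bar>(A \<odot> x) w\<bar> \<le> real n * M * (2 * real CARD('d)) ^ n * C * (1 / (2 * real CARD('d))) ^ length w"
proof -
  let ?d = "2 * real CARD('d)"
  have d: "1 \<le> ?d"
    using zero_less_card_finite[where 'a = 'd] by linarith
  have M: "0 \<le> M" using xM[of "[]"] by simp
  have "(A \<odot> x) w = (\<Sum>i\<in>{length w - n..<length w}. A (take i w) * x (drop i w))"
    unfolding tmult_def using x
    by (intro sum.mono_neutral_right) (auto simp: trunc_space_def not_le not_less)
  also have "\<bar>\<dots>\<bar> \<le> (\<Sum>i\<in>{length w - n..<length w}. \<bar>A (take i w) * x (drop i w)\<bar>)"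
    by (rule sum_abs)
  also have "\<dots> \<le> real (card {length w - n..<length w}) * (C * (?d ^ n * (1 / ?d) ^ length w) * M)"
  proof (rule sum_bounded_above)
    fix i assume i: "i \<in> {length w - n..<length w}"
    have "(1 / ?d) ^ i = ?d ^ (length w - i) * (1 / ?d) ^ length w"
      using i d by (simp add: power_diff power_divide field_simps)
    also have "\<dots> \<le> ?d ^ n * (1 / ?d) ^ length w"
      using i d by (intro mult_right_mono power_increasing) auto
    finally have "C * (1 / ?d) ^ i \<le> C * (?d ^ n * (1 / ?d) ^ length w)"
      using C by (intro mult_left_mono)
    moreover have "\<bar>A (take i w)\<bar> \<le> C * (1 / ?d) ^ i"
      using A[of "take i w"] i by simp
    ultimately have "\<bar>A (take i w)\<bar> \<le> C * (?d ^ n * (1 / ?d) ^ length w)"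
      by (rule order_trans[rotated])
    then show "\<bar>A (take i w) * x (drop i w)\<bar> \<le> C * (?d ^ n * (1 / ?d) ^ length w) * M"
      unfolding abs_mult using C by (intro mult_mono xM) auto
  qed
  also have "\<dots> \<le> real n * (C * (?d ^ n * (1 / ?d) ^ length w) * M)"
    using C M by (intro mult_right_mono) auto
  also have "\<dots> = real n * M * ?d ^ n * C * (1 / ?d) ^ length w"
    by (simp only: mult_ac)
  finally show ?thesis .
qed

section \<open>Signatures\<close>

text \<open>When \<open>x\<close> has no scalar part, the signature equation at \<open>w\<close>
  refers to shorter prefixes only, so it is solved by one integration per word.\<close>

function iterated_integral :: "(real \<Rightarrow> 'd tens) \<Rightarrow> 'd list \<Rightarrow> real \<Rightarrow> real"
  where "iterated_integral x w = (if w = [] then (\<lambda>_. 1) else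
    (\<lambda>s. integral {0..s} (\<lambda>r. \<Sum>i<length w. iterated_integral x (take i w) r * x r (drop i w))))"
  by auto
termination by (relation "Wellfounded.measure (\<lambda>(x, w). length w)") auto

declare iterated_integral.simps [simp del]

lemma iterated_integral_has_derivative:
  assumes x: "\<And>w. continuous_on {0..T} (\<lambda>s. x s w)" and s: "s \<in> {0..T}"
  shows "(iterated_integral x w has_real_derivative
    (\<Sum>i<length w. iterated_integral x (take i w) s * x s (drop i w))) (at s within {0..T})"
  using s
proof (induction "length w" arbitrary: w s rule: less_induct)
  case less
  show ?case
  proof (cases "w = []")
    case True
    then show ?thesis
      by (subst iterated_integral.simps) simp
  next
    case False
    have "continuous_on {0..T} (iterated_integral x (take i w))" if "i < length w" for i
      by (rule DERIV_continuous_on, rule less.hyps) (use that in auto)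
    then have "continuous_on {0..T} (\<lambda>r. \<Sum>i<length w. iterated_integral x (take i w) r * x r (drop i w))"
      by (auto intro!: continuous_intros x)
    from integral_has_real_derivative[OF this less.prems] show ?thesis
      by (subst iterated_integral.simps) (simp add: False)
  qed
qed

lemma equal_on_interval:
  fixes f g :: "real \<Rightarrow> real"
  assumes "\<And>s. s \<in> {0..T} \<Longrightarrow> (f has_real_derivative D s) (at s within {0..T})"
    "\<And>s. s \<in> {0..T} \<Longrightarrow> (g has_real_derivative D s) (at s within {0..T})"
    "f 0 = g 0" "s \<in> {0..T}"
  shows "f s = g s"
proof -
  have "\<exists>c. \<forall>s\<in>{0..T}. f s - g s = c"
    using DERIV_diff[OF assms(1,2)]
    by (intro has_field_derivative_zero_constant) auto
  then obtain c where "\<forall>s\<in>{0..T}. f s - g s = c" ..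
  moreover from this have "c = 0" using assms(3,4) by force
  ultimately show ?thesis using assms(4) by simp
qed

context smooth_rough_path
begin

abbreviation "S \<equiv> signature T n X"

lemma is_signature: "is_signature T n X S"
proof -
  have "is_signature T n X (\<lambda>s w. iterated_integral x w s)"
    unfolding is_signature_def has_tens_derivative_def
  proof (intro conjI ballI allI)
    show "(\<lambda>w. iterated_integral x w 0) = \<one>\<^sub>T"
    proof
      show "iterated_integral x w 0 = \<one>\<^sub>T w" for w
        by (subst iterated_integral.simps) (simp add: tunit_def)
    qed
    fix s w assume "s \<in> I"
    then show "((\<lambda>u. iterated_integral x w u) has_real_derivative
        ((\<lambda>w. iterated_integral x w s) \<odot> x s) w) (at s within I)"
      using iterated_integral_has_derivative[where x = x and T = T and s = s and w = w, OF continuous_on_x]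
      by (simp add: tmult_eq_sum_below)
  qed
  then show ?thesis
    unfolding signature_def by (rule someI[of "is_signature T n X"])
qed

lemma S_0 [simp]: "S 0 = \<one>\<^sub>T"
  using is_signature by (simp add: is_signature_def)

lemma S_has_derivative:
  "s \<in> I \<Longrightarrow> ((\<lambda>u. S u w) has_real_derivative (S s \<odot> x s) w) (at s within I)"
  using is_signature by (simp add: is_signature_def has_tens_derivative_def)

lemma S_Nil [simp]:
  assumes "s \<in> I"
  shows "S s [] = 1"
proof (rule equal_on_interval[where f = "\<lambda>u. S u []" and D = "\<lambda>_. 0" and g = "\<lambda>_. 1"])
  show "((\<lambda>u. S u []) has_real_derivative 0) (at s within I)" if "s \<in> I" for s
    using S_has_derivative[OF that, of "[]"] that by simp
qed (use assms in \<open>auto simp: tunit_def\<close>)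

text \<open>By induction both sides agree on proper prefixes, so their derivatives at
  \<open>w\<close> coincide, and so do their initial values.\<close>

lemma S_trunc:
  assumes "s \<in> I" "length w \<le> n"
  shows "S s w = increment n X 0 s w"
  using assms
proof (induction "length w" arbitrary: w s rule: less_induct)
  case less
  show ?case
  proof (rule equal_on_interval[where f = "\<lambda>u. S u w" and D = "\<lambda>u. (S u \<odot> x u) w"
        and g = "\<lambda>u. increment n X 0 u w"])
    show "((\<lambda>u. S u w) has_real_derivative (S u \<odot> x u) w) (at u within I)" if "u \<in> I" for u
      by (rule S_has_derivative[OF that])
    show "((\<lambda>u. increment n X 0 u w) has_real_derivative (S u \<odot> x u) w) (at u within I)" if "u \<in> I" for u
    proof -
      have "(S u \<odot> x u) w = (increment n X 0 u \<odot> x u) w"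
        unfolding tmult_eq_sum_below using that less by simp
      then show ?thesis
        using increment_has_derivative[OF that, of w] less.prems by (simp add: ttrunc_def)
    qed
  qed (use less.prems in \<open>simp_all add: increment_self\<close>)
qed

section \<open>Uniform bounds on the signature\<close>

lemma x_bounded:
  obtains M where "\<And>s w. s \<in> I \<Longrightarrow> \<bar>x s w\<bar> \<le> M"
proof -
  have "\<forall>w. \<exists>B\<ge>0. \<forall>s\<in>I. \<bar>x s w\<bar> \<le> B"
    using continuous_on_compact_bound[OF compact_Icc continuous_on_x] by (metis real_norm_def)
  from choice[OF this] obtain B where B: "\<forall>w. B w \<ge> 0 \<and> (\<forall>s\<in>I. \<bar>x s w\<bar> \<le> B w)" ..
  have fin: "finite {w :: 'd list. length w \<le> n}"
    using finite_lists_length_le[of "UNIV :: 'd set" n] by simp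
  have "\<bar>x s w\<bar> \<le> (\<Sum>w | length w \<le> n. B w)" if "s \<in> I" for s w
  proof (cases "length w \<le> n")
    case True
    then have "B w \<le> (\<Sum>w | length w \<le> n. B w)"
      using B fin by (intro member_le_sum) auto
    then show ?thesis using B that by (meson order_trans)
  next
    case False
    then show ?thesis
      using x_trunc[OF that] B by (simp add: trunc_space_def sum_nonneg)
  qed
  then show thesis by (rule that)
qed

text \<open>A Gronwall argument by induction on word length. \<open>K\<close> is the constant of
  \<open>tmult_le\<close>, independent of the word, so the bound obtained for the derivative is
  exactly the derivative of the claimed bound \<open>exp (K * s) * ?q ^ length w\<close>.\<close>

lemma S_decays: "\<exists>C. \<forall>s\<in>I. decays C (S s) \<and> decays C (S s \<odot> x s)"
proof -
  obtain M where M: "\<And>s w. s \<in> I \<Longrightarrow> \<bar>x s w\<bar> \<le> M"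
    by (rule x_bounded) blast
  let ?q = "1 / (2 * real CARD('d))"
  define K where "K = real n * M * (2 * real CARD('d)) ^ n"
  have "0 \<le> M" using M[of 0 "[]"] T by simp
  then have K: "0 \<le> K" by (simp add: K_def)
  have Sx: "\<bar>(S s \<odot> x s) w\<bar> \<le> K * exp (K * s) * ?q ^ length w"
    if "s \<in> I" "\<And>v. length v < length w \<Longrightarrow> \<bar>S s v\<bar> \<le> exp (K * s) * ?q ^ length v" for s w
    unfolding K_def using that by (intro tmult_le x_trunc x_Nil M) (auto simp: K_def)
  have S: "\<bar>S s w\<bar> \<le> exp (K * s) * ?q ^ length w" if "s \<in> I" for s w
    using that
  proof (induction "length w" arbitrary: w s rule: less_induct)
    case less
    show ?case
    proof (cases "w = [] \<or> s = 0")
      case True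
      then show ?thesis
        using less.prems K by (auto simp: tunit_def)
    next
      case False
      \<comment> \<open>The mean value comparison asks for two-sided derivatives, available at
        interior points.\<close>
      have *: "at r within I = at r" if "0 < r" "r < s" for r
        using that less.prems by (intro at_within_Icc_at) auto
      have "norm (S s w - S 0 w) \<le> exp (K * s) * ?q ^ length w - exp (K * 0) * ?q ^ length w"
      proof (rule differentiable_bound_general)
        show "0 < s" using less.prems False by auto
        show "continuous_on {0..s} (\<lambda>s. S s w)"
          by (rule continuous_on_subset[of I], rule DERIV_continuous_on, rule S_has_derivative)
            (use less.prems in auto)
        show "continuous_on {0..s} (\<lambda>r. exp (K * r) * ?q ^ length w)"
          by (intro continuous_intros)
        fix r assume r: "0 < r" "r < s"
        then have rI: "r \<in> I" using less.prems by simp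
        show "((\<lambda>s. S s w) has_vector_derivative (S r \<odot> x r) w) (at r)"
          using S_has_derivative[OF rI, of w] unfolding *[OF r] has_real_derivative_iff_has_vector_derivative .
        show "((\<lambda>r. exp (K * r) * ?q ^ length w) has_vector_derivative K * exp (K * r) * ?q ^ length w) (at r)"
          unfolding has_real_derivative_iff_has_vector_derivative[symmetric]
          by (auto intro!: derivative_eq_intros)
        show "norm ((S r \<odot> x r) w) \<le> K * exp (K * r) * ?q ^ length w"
          using Sx[OF rI less.hyps] rI by simp
      qed
      then have "\<bar>S s w\<bar> \<le> exp (K * s) * ?q ^ length w - ?q ^ length w"
        using False by (simp add: tunit_def)
      also have "\<dots> \<le> exp (K * s) * ?q ^ length w"
        by simp
      finally show ?thesis .
    qed
  qed
  \<comment> \<open>The summand 1 covers \<open>S s\<close>, the summand \<open>K\<close> covers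
    \<open>S s \<odot> x s\<close>.\<close>
  define C where "C = (1 + K) * exp (K * T)"
  have "decays C (S s) \<and> decays C (S s \<odot> x s)" if s: "s \<in> I" for s
  proof -
    have e: "exp (K * s) \<le> exp (K * T)"
      using s K by (simp add: mult_left_mono)
    have "decays (exp (K * s)) (S s)"
      using S[OF s] by (simp add: decays_def)
    moreover have "decays (K * exp (K * s)) (S s \<odot> x s)"
      using Sx[OF s S[OF s]] by (simp add: decays_def)
    moreover have "exp (K * s) \<le> C" "K * exp (K * s) \<le> C"
      using e K mult_left_mono[OF e K] by (simp_all add: C_def distrib_right add_increasing2 add_increasing)
    ultimately show ?thesis
      using decays_mono by blast
  qed
  then show ?thesis by blast
qed

lemma ex_decays:
  assumes "s \<in> I"
  shows "\<exists>C. decays C (S s)" and "\<exists>C. decays C (S s \<odot> x s)"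
proof -
  from S_decays obtain C where C: "\<forall>s\<in>I. decays C (S s) \<and> decays C (S s \<odot> x s)" ..
  show "\<exists>C. decays C (S s)"
    using C assms by (intro exI[of _ C]) simp
  show "\<exists>C. decays C (S s \<odot> x s)"
    using C assms by (intro exI[of _ C]) simp
qed

end

section \<open>The system for two rough paths\<close>

locale two_rough_paths = X: smooth_rough_path T n X + Y: smooth_rough_path T n Y
  for T :: real and n :: nat and X Y :: "real \<Rightarrow> 'd::finite tens"
begin

abbreviation "f s t \<equiv> tinner (X.S s) (Y.S t)"
abbreviation "\<phi> s t \<equiv> ttrunc n (left_adj (Y.S t) (X.S s) - f s t *\<^sub>R \<one>\<^sub>T)"
abbreviation "\<psi> s t \<equiv> ttrunc n (left_adj (X.S s) (Y.S t) - f s t *\<^sub>R \<one>\<^sub>T)"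

lemma summable_pairings:
  assumes "s \<in> X.I" "t \<in> X.I"
  shows "summable (\<lambda>k. level_inner k (X.S s) (\<lambda>v. Y.S t (v @ u)))"
    and "summable (\<lambda>k. level_inner k (Y.S t) (\<lambda>v. X.S s (v @ u)))"
    and "summable (\<lambda>k. level_inner k (Y.S t) (\<lambda>v. (X.S s \<odot> X.x s) (v @ u)))"
proof -
  from X.ex_decays(1)[OF assms(1)] X.ex_decays(2)[OF assms(1)] Y.ex_decays(1)[OF assms(2)]
  obtain C C' D where d: "decays C (X.S s)" "decays C' (X.S s \<odot> X.x s)" "decays D (Y.S t)"
    by (elim exE)
  show "summable (\<lambda>k. level_inner k (X.S s) (\<lambda>v. Y.S t (v @ u)))"
    by (rule summable_level_inner[OF d(1) decays_bounded[OF d(3)]])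
  show "summable (\<lambda>k. level_inner k (Y.S t) (\<lambda>v. X.S s (v @ u)))"
    by (rule summable_level_inner[OF d(3) decays_bounded[OF d(1)]])
  show "summable (\<lambda>k. level_inner k (Y.S t) (\<lambda>v. (X.S s \<odot> X.x s) (v @ u)))"
    by (rule summable_level_inner[OF d(3) decays_bounded[OF d(2)]])
qed

text \<open>The suffix \<open>w\<close> is there for the coordinates of the adjoint; the empty
  suffix gives \<open>f\<close>.\<close>

lemma tinner_S_has_derivative:
  assumes s: "s \<in> X.I" and B: "decays C B"
  shows "((\<lambda>u. tinner B (\<lambda>v. X.S u (v @ w))) has_real_derivative
    tinner B (\<lambda>v. (X.S s \<odot> X.x s) (v @ w))) (at s within X.I)"
proof -
  from X.S_decays obtain C' where C': "\<forall>s\<in>X.I. decays C' (X.S s) \<and> decays C' (X.S s \<odot> X.x s)" ..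
  show ?thesis
  proof (rule has_real_derivative_tinner[OF _ s B])
    fix u v assume u: "u \<in> X.I"
    show "((\<lambda>u. X.S u (v @ w)) has_real_derivative (X.S u \<odot> X.x u) (v @ w)) (at u within X.I)"
      by (rule X.S_has_derivative[OF u])
    have d: "decays C' (X.S u)" "decays C' (X.S u \<odot> X.x u)"
      using C' u by simp_all
    show "\<bar>X.S u (v @ w)\<bar> \<le> C'"
      by (rule decays_bounded[OF d(1)])
    show "\<bar>(X.S u \<odot> X.x u) (v @ w)\<bar> \<le> C'"
      by (rule decays_bounded[OF d(2)])
  qed simp
qed

lemma tinner_S_has_derivative_left:
  assumes s: "s \<in> X.I" and B: "decays C B"
  shows "((\<lambda>u. tinner (X.S u) B) has_real_derivative tinner (X.S s \<odot> X.x s) B) (at s within X.I)"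
proof -
  have "tinner (X.S s \<odot> X.x s) B = tinner B (X.S s \<odot> X.x s)"
    "(\<lambda>u. tinner (X.S u) B) = (\<lambda>u. tinner B (X.S u))"
    by (rule tinner_commute, rule ext, rule tinner_commute)
  then show ?thesis
    using tinner_S_has_derivative[OF s B, of "[]"] by (simp only: append_Nil2)
qed

lemma f_has_derivative:
  assumes "s \<in> X.I" "t \<in> X.I"
  shows "((\<lambda>u. f u t) has_real_derivative tinner (X.S s \<odot> X.x s) (Y.S t)) (at s within X.I)"
  using Y.ex_decays(1)[OF assms(2)] by (elim exE) (rule tinner_S_has_derivative_left[OF assms(1)])

lemma left_adj_S:
  assumes "s \<in> X.I" "t \<in> X.I"
  shows "left_adj (Y.S t) (X.S s) = (\<lambda>u. tinner (Y.S t) (\<lambda>v. X.S s (v @ u)))"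
    and "left_adj (X.S s) (Y.S t) = (\<lambda>u. tinner (X.S s) (\<lambda>v. Y.S t (v @ u)))"
  using left_adj_eq[OF summable_pairings(2)[OF assms]] left_adj_eq[OF summable_pairings(1)[OF assms]]
  by simp_all

text \<open>For fixed \<open>t\<close> the tensor \<open>Y.S t \<odot> Y.x t\<close> decays as well,
  so the first derivative can be differentiated in \<open>s\<close> like \<open>f\<close>
  itself.\<close>

lemma derivative_f_has_derivative:
  assumes st: "s \<in> X.I" "t \<in> X.I"
  shows "((\<lambda>u. tinner (X.S u) (Y.S t \<odot> Y.x t)) has_real_derivative
    tinner (X.x s) (Y.x t) * f s t + tinner (\<phi> s t) (right_adj (X.x s) (Y.x t))
      + tinner (\<psi> s t) (right_adj (Y.x t) (X.x s))) (at s within X.I)"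
proof -
  from Y.ex_decays(2)[OF st(2)] obtain C where "decays C (Y.S t \<odot> Y.x t)" ..
  from tinner_S_has_derivative_left[OF st(1) this] show ?thesis
    using tinner_tmult_tmult[OF summable_pairings[OF st] X.x_trunc[OF st(1)] X.x_Nil[OF st(1)] Y.x_trunc[OF st(2)]]
    by (simp add: left_adj_S[OF st])
qed

lemma \<phi>_Nil: "s \<in> X.I \<Longrightarrow> t \<in> X.I \<Longrightarrow> \<phi> s t [] = 0"
  by (simp add: left_adj_S ttrunc_def scaleR_fun_def tunit_def tinner_commute)

text \<open>At the empty word \<open>\<phi>\<close> is constantly zero and the subtracted multiple
  of the unit cancels the scalar part of the adjoint. Beyond length \<open>n\<close> both sides
  vanish. In between the unit is invisible and \<open>tinner_tmult_append\<close> applies.\<close>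

lemma \<phi>_has_derivative:
  assumes st: "s \<in> X.I" "t \<in> X.I"
  shows "has_tens_derivative (\<lambda>u. \<phi> u t)
    (f s t *\<^sub>R X.x s + tmult_trunc n (\<phi> s t) (X.x s)
      + left_adj (\<psi> s t) (X.x s) - tinner (\<psi> s t) (X.x s) *\<^sub>R \<one>\<^sub>T) (at s within X.I)"
  unfolding has_tens_derivative_def
proof
  fix w
  let ?R = "f s t *\<^sub>R X.x s + tmult_trunc n (\<phi> s t) (X.x s)
      + left_adj (\<psi> s t) (X.x s) - tinner (\<psi> s t) (X.x s) *\<^sub>R \<one>\<^sub>T"
  have R: "?R w = f s t * X.x s w + ttrunc n (\<phi> s t \<odot> X.x s) w
      + left_adj (\<psi> s t) (X.x s) w - tinner (\<psi> s t) (X.x s) * \<one>\<^sub>T w"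
    by (simp add: scaleR_fun_def tmult_trunc_def)
  consider "w = []" | "n < length w" | "w \<noteq> []" "length w \<le> n" by force
  then show "((\<lambda>u. \<phi> u t w) has_real_derivative ?R w) (at s within X.I)"
  proof cases
    case 1
    have "?R w = 0"
      unfolding R using 1 st by (simp add: left_adj_trunc[OF X.x_trunc[OF st(1)]] tunit_def ttrunc_def)
    then show ?thesis
      using has_real_derivative_eq_on[OF DERIV_const[of 0 "at s within X.I"], of "\<lambda>u. \<phi> u t w"] \<phi>_Nil st 1
      by simp
  next
    case 2
    then have "X.x s (v @ w) = 0" for v
      using X.x_trunc[OF st(1)] by (simp add: trunc_space_def)
    from this this[of "[]"] have "?R w = 0"
      unfolding R left_adj_trunc[OF X.x_trunc[OF st(1)]] using 2
      by (auto simp: tunit_def ttrunc_def tinner_def level_inner_def)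
    then show ?thesis
      using 2 by (simp add: ttrunc_def)
  next
    case 3
    from Y.ex_decays(1)[OF st(2)] obtain C where "decays C (Y.S t)" ..
    note tinner_S_has_derivative[OF st(1) this, of w]
    moreover have "tinner (Y.S t) (\<lambda>v. (X.S s \<odot> X.x s) (v @ w)) = ?R w"
      using tinner_tmult_append[OF summable_pairings(1,2)[OF st] X.x_trunc[OF st(1)] X.x_Nil[OF st(1)] 3(2)]
        3 unfolding R
      by (simp add: left_adj_S[OF st] ttrunc_apply tunit_def del: ttrunc_tmult_ttrunc_left)
    ultimately have "((\<lambda>u. tinner (Y.S t) (\<lambda>v. X.S u (v @ w))) has_real_derivative ?R w) (at s within X.I)"
      by simp
    then show ?thesis
      by (rule has_real_derivative_eq_on)
        (use 3 st in \<open>auto simp: left_adj_S ttrunc_def scaleR_fun_def tunit_def\<close>)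
  qed
qed

text \<open>At \<open>s = 0\<close> the adjoint is applied to the unit, and a shift of the unit by a
  nonempty suffix is zero.\<close>

lemma boundary_left:
  assumes t: "t \<in> X.I"
  shows "f 0 t = 1" and "\<phi> 0 t = 0"
proof -
  have 0: "0 \<in> X.I" using X.T by simp
  show f: "f 0 t = 1"
    using t by (simp add: tinner_commute[of "\<one>\<^sub>T"] tinner_tunit)
  have "tinner (Y.S t) (\<lambda>v. \<one>\<^sub>T (v @ u)) = \<one>\<^sub>T u" for u
  proof (cases "u = []")
    case True
    then show ?thesis using t by (simp add: tinner_tunit) (simp add: tunit_def)
  qed (simp add: tunit_def tinner_def level_inner_def)
  then show "\<phi> 0 t = 0"
    unfolding left_adj_S[OF 0 t] f by (auto simp: ttrunc_def scaleR_fun_def)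
qed

text \<open>At \<open>t = 0\<close> the adjoint of multiplication by the unit is the identity, so
  \<open>S_trunc\<close> identifies the truncation.\<close>

lemma boundary_right:
  assumes s: "s \<in> X.I"
  shows "f s 0 = 1" and "\<phi> s 0 = increment n X 0 s - \<one>\<^sub>T"
proof -
  have 0: "0 \<in> X.I" using X.T by simp
  show f: "f s 0 = 1"
    using s by (simp add: tinner_tunit)
  have "tinner \<one>\<^sub>T (\<lambda>v. X.S s (v @ u)) = X.S s u" for u
    by (simp add: tinner_commute[of "\<one>\<^sub>T"] tinner_tunit)
  moreover have "increment n X 0 s w = 0" if "n < length w" for w
    using that by (simp add: increment_def tmult_trunc_def ttrunc_def)
  ultimately show "\<phi> s 0 = increment n X 0 s - \<one>\<^sub>T"
    unfolding left_adj_S[OF s 0] f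
    by (auto simp: ttrunc_def scaleR_fun_def X.S_trunc[OF s] tunit_def not_le)
qed

end

theorem mainTheorem5:
  fixes X Y x y SX SY :: "real \<Rightarrow> 'd::finite tens"
    and f :: "real \<Rightarrow> real \<Rightarrow> real"
    and \<phi> \<psi> :: "real \<Rightarrow> real \<Rightarrow> 'd tens"
    and n :: nat and T :: real
  assumes "n \<ge> 1" and "T > 0"
    and "smooth_geometric_rough_path T n X"
    and "smooth_geometric_rough_path T n Y"
    and "x = diag_deriv T n X"
    and "y = diag_deriv T n Y"
    and "SX = signature T n X"
    and "SY = signature T n Y"
    and "f = (\<lambda>s t. tinner (SX s) (SY t))"
    and "\<phi> = (\<lambda>s t. ttrunc n (left_adj (SY t) (SX s) - f s t *\<^sub>R \<one>\<^sub>T))"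
    and "\<psi> = (\<lambda>s t. ttrunc n (left_adj (SX s) (SY t) - f s t *\<^sub>R \<one>\<^sub>T))"
  shows
    "(\<forall>s\<in>{0..T}. x s \<in> lie_algebra n) \<and>
     (\<forall>t\<in>{0..T}. y t \<in> lie_algebra n) \<and>
     has_mixed_partial_on f
       (\<lambda>s t. tinner (x s) (y t) * f s t
              + tinner (\<phi> s t) (right_adj (x s) (y t))
              + tinner (\<psi> s t) (right_adj (y t) (x s)))
       {0..T} {0..T} \<and>
     (\<forall>s\<in>{0..T}. \<forall>t\<in>{0..T}.
       has_tens_derivative (\<lambda>u. \<phi> u t)
         (f s t *\<^sub>R x s + tmult_trunc n (\<phi> s t) (x s)
          + left_adj (\<psi> s t) (x s) - tinner (\<psi> s t) (x s) *\<^sub>R \<one>\<^sub>T)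
         (at s within {0..T}) \<and>
       has_tens_derivative (\<lambda>v. \<psi> s v)
         (f s t *\<^sub>R y t + tmult_trunc n (\<psi> s t) (y t)
          + left_adj (\<phi> s t) (y t) - tinner (\<phi> s t) (y t) *\<^sub>R \<one>\<^sub>T)
         (at t within {0..T})) \<and>
     (\<forall>t\<in>{0..T}. f 0 t = 1 \<and> \<psi> 0 t = increment n Y 0 t - \<one>\<^sub>T \<and> \<phi> 0 t = 0) \<and>
     (\<forall>s\<in>{0..T}. f s 0 = 1 \<and> \<phi> s 0 = increment n X 0 s - \<one>\<^sub>T \<and> \<psi> s 0 = 0)"
proof -
  interpret XY: two_rough_paths T n X Y
    by unfold_locales (use assms in auto)
  \<comment> \<open>With the roles exchanged, \<open>YX.\<phi> t s\<close> is
    \<open>\<psi> s t\<close> up to the symmetry of \<open>f\<close>.\<close>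
  interpret YX: two_rough_paths T n Y X ..
  have f_sym: "YX.f t s = XY.f s t" for s t
    by (rule tinner_commute)
  let ?F = "\<lambda>s t. tinner (x s) (y t) * f s t + tinner (\<phi> s t) (right_adj (x s) (y t))
      + tinner (\<psi> s t) (right_adj (y t) (x s))"
  have "has_mixed_partial_on f ?F {0..T} {0..T}"
    unfolding has_mixed_partial_on_def
  \<comment> \<open>The two first-order derivatives stay schematic here and are determined by the
    claims that follow.\<close>
  proof (intro conjI exI ballI)
    fix s t assume st: "s \<in> {0..T}" "t \<in> {0..T}"
    show "((\<lambda>v. f s v) has_real_derivative tinner (SX s) (SY t \<odot> y t)) (at t within {0..T})"
      using YX.f_has_derivative[OF st(2,1)]
      by (simp only: assms f_sym tinner_commute[of "XY.Y.S t \<odot> XY.Y.x t" "XY.X.S s"])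
    show "((\<lambda>u. tinner (SX u) (SY t \<odot> y t)) has_real_derivative ?F s t) (at s within {0..T})"
      using XY.derivative_f_has_derivative[OF st] by (simp add: assms)
    show "((\<lambda>u. f u t) has_real_derivative tinner (SX s \<odot> x s) (SY t)) (at s within {0..T})"
      using XY.f_has_derivative[OF st] by (simp add: assms)
    have "?F s t = tinner (y t) (x s) * YX.f t s + tinner (YX.\<phi> t s) (right_adj (y t) (x s))
        + tinner (YX.\<psi> t s) (right_adj (x s) (y t))"
      by (simp add: assms f_sym add_ac tinner_commute[of "diag_deriv T n Y t" "diag_deriv T n X s"])
    with YX.derivative_f_has_derivative[OF st(2,1)]
    show "((\<lambda>v. tinner (SX s \<odot> x s) (SY v)) has_real_derivative ?F s t) (at t within {0..T})"
      by (simp only: assms tinner_commute[of "XY.X.S s \<odot> XY.X.x s"])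
  qed
  then show ?thesis
    using XY.\<phi>_has_derivative YX.\<phi>_has_derivative XY.boundary_left YX.boundary_left
      XY.boundary_right YX.boundary_right XY.X.x_in_lie_algebra XY.Y.x_in_lie_algebra
    unfolding f_sym by (simp add: assms)
qed

end
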